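(* Let $X$ be an infinite-dimensional Banach space over $\mathbb{K}\in\{\mathbb{R},\mathbb{C}\}$ and let $(x_i)_{i\in\mathbb{N}}$ be a Markushevich basis for $X$. The following are equivalent: (i) For every $0<\tau\le 1$, $(x_i)_i$ is WSG($\tau$). (ii) There is $0<\tau\le 1$ such that $(x_i)_i$ is WSG($\tau$). (iii) For every $0<\tau\le 1$, $(x_i)_i$ is WAG($\tau$). (iv) There is $0<\tau\le 1$ such that $(x_i)_i$ is WAG($\tau$). (v) $(x_i)_i$ is semi-greedy. (vi) $(x_i)_i$ is almost greedy.
   Context: $[\,\cdot\,]$ denotes linear span and $X'$ the dual. A Markushevich basis is a sequence $(x_i)_i$ with $X=\overline{[x_i:i\in\mathbb{N}]}$ having biorthogonal functionals $(x_i')_i\subseteq X'$ ($x_i'(x_j)=\delta_{ij}$) which are total ($x_i'(x)=0$ for all $i$ implies $x=0$). It has bounded coordinates if $\sup_i\|x_i'\|<\infty$. $\mathrm{supp}(x)=\{i:x_i'(x)\ne0\}$; for finite $A\subseteq\mathbb{N}$, $P_A(x)=\sum_{i\in A}x_i'(x)x_i$. $\sigma_m(x)=\inf\{\|x-y\|: |\mathrm{supp}(y)|\le m,\ y=P_{\mathrm{supp}(y)}(y)\}$ and $\widetilde\sigma_m(x)=\inf\{\|x-P_A(x)\|:|A|\le m\}$. Greedy ordering (bounded coordinates): a decreasing ordering for $x$ is an injective $\varrho:\mathbb{N}\to\mathbb{N}$ with $\mathrm{supp}(x)\subseteq\varrho(\mathbb{N})$ and $|x'_{\varrho(i)}(x)|\ge|x'_{\varrho(j)}(x)|$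 for $i\le j$; the greedy ordering $\rho(x,\cdot)$ is the decreasing ordering for which $i<j$ and $|x'_{\rho(x,i)}(x)|=|x'_{\rho(x,j)}(x)|$ imply $\rho(x,i)<\rho(x,j)$. $\mathcal{GS}_m(x)=\{\rho(x,i):1\le i\le m\}$ and $\mathcal{G}_m(x)=P_{\mathcal{GS}_m(x)}(x)$, $\mathcal{G}_0(x)=0$. Almost greedy: bounded coordinates and there is $M>0$ with $\|x-\mathcal{G}_m(x)\|\le M\widetilde\sigma_m(x)$ for all $x\in X$, $m\in\mathbb{N}_0$. Semi-greedy: bounded coordinates and there is $M>0$ such that for all $x\in X$, $m\in\mathbb{N}$ there is $z\in[x_i:i\in\mathcal{GS}_m(x)]$ with $\|x-z\|\le M\sigma_m(x)$. For $0<\tau\le1$, an $m$-weak thresholding set for $x$ with weakness parameter $\tau$ is a set $\mathcal{W}^\tau(x,m)\subseteq\mathbb{N}$ of cardinality $m$ with $|x_i'(x)|\ge\tau|x_j'(x)|$ for all $i\in\mathcal{W}^\tau(x,m)$, $j\notin\mathcal{W}^\tau(x,m)$. WAG($\tau$): there is $M>0$ such that for all $x\in X$, $m\in\mathbb{N}$ there is a weak thresholding set $\mathcal{W}^\tau(x,m)$ with $\|x-P_{\mathcal{W}^\tau(x,m)}(x)\|\le M\widetilde\sigma_m(x)$. WSG($\tau$): there is $M>0$ such that for all $x\in X$, $m\in\mathbb{N}$ there are a weak thresholding set $\mathcal{W}^\tau(x,m)$ and $z\in[x_i:i\in\mathcal{W}^\tau(x,m)]$ with $\|x-z\|\le M\sigma_m(x)$.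 *)

theory Defs
  imports "HOL-Analysis.Analysis"
begin

text \<open>
  Scalars: a commutative real normed division algebra of finite dimension is isometrically
  isomorphic to the reals or to the complex numbers (Frobenius), so the sort
  \<open>{real_normed_field, euclidean_space}\<close>, of which both are instances, ranges over exactly these
  two fields.  The class \<open>banach\<close> only provides the underlying real Banach space;
  the scalar multiplication of the field is \<open>smul\<close>.
\<close>

locale banach_space_over = vector_space smul
  for smul :: "'k::{real_normed_field, euclidean_space} \<Rightarrow> 'a::banach \<Rightarrow> 'a" +
  assumes smul_of_real: "smul (of_real r) v = r *\<^sub>R v"
    and norm_smul: "norm (smul c v) = norm c * norm v"

lemma banach_space_over_real: "banach_space_over (scaleR :: real \<Rightarrow> 'a::banach \<Rightarrow> 'a)"
  by unfold_locales (simp_all add: scaleR_add_right scaleR_add_left)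

lemma banach_space_over_complex: "banach_space_over ((*) :: complex \<Rightarrow> complex \<Rightarrow> complex)"
  by unfold_locales (simp_all add: algebra_simps norm_mult scaleR_conv_of_real)

definition infinite_dimensional :: "('k::field \<Rightarrow> 'a::ab_group_add \<Rightarrow> 'a) \<Rightarrow> bool" where
  "infinite_dimensional smul \<longleftrightarrow> \<not> (\<exists>B. finite B \<and> module.span smul B = UNIV)"

definition dual_space :: "('k::real_normed_field \<Rightarrow> 'a::real_normed_vector \<Rightarrow> 'a) \<Rightarrow> ('a \<Rightarrow> 'k) set" where
  "dual_space smul = {f. Vector_Spaces.linear smul (*) f \<and> bounded_linear f}"

text \<open>
  The sequence \<open>e\<close> is the basis and \<open>e'\<close> its sequence of biorthogonal functionals; the latter
  is uniquely determined by \<open>e\<close>, since the span of \<open>e\<close> is dense.  Sequences are indexed from 0.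
\<close>

definition markushevich_basis ::
    "('k::real_normed_field \<Rightarrow> 'a::real_normed_vector \<Rightarrow> 'a) \<Rightarrow> (nat \<Rightarrow> 'a) \<Rightarrow> (nat \<Rightarrow> 'a \<Rightarrow> 'k) \<Rightarrow> bool" where
  "markushevich_basis smul e e' \<longleftrightarrow>
     closure (module.span smul (range e)) = UNIV \<and>
     (\<forall>i. e' i \<in> dual_space smul) \<and>
     (\<forall>i j. e' i (e j) = (if i = j then 1 else 0)) \<and>
     (\<forall>v. (\<forall>i. e' i v = 0) \<longrightarrow> v = 0)"

definition bounded_coordinates :: "(nat \<Rightarrow> 'a::real_normed_vector \<Rightarrow> 'k::real_normed_field) \<Rightarrow> bool" where
  "bounded_coordinates e' \<longleftrightarrow> bdd_above (range (\<lambda>i. onorm (e' i)))"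

definition supp :: "(nat \<Rightarrow> 'a \<Rightarrow> 'k::zero) \<Rightarrow> 'a \<Rightarrow> nat set" where
  "supp e' v = {i. e' i v \<noteq> 0}"

definition proj ::
    "('k \<Rightarrow> 'a \<Rightarrow> 'a::comm_monoid_add) \<Rightarrow> (nat \<Rightarrow> 'a) \<Rightarrow> (nat \<Rightarrow> 'a \<Rightarrow> 'k) \<Rightarrow> nat set \<Rightarrow> 'a \<Rightarrow> 'a" where
  "proj smul e e' A v = (\<Sum>i\<in>A. smul (e' i v) (e i))"

definition best_error ::
    "('k::real_normed_field \<Rightarrow> 'a::real_normed_vector \<Rightarrow> 'a) \<Rightarrow> (nat \<Rightarrow> 'a) \<Rightarrow> (nat \<Rightarrow> 'a \<Rightarrow> 'k) \<Rightarrow> nat \<Rightarrow> 'a \<Rightarrow> real" where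
  "best_error smul e e' m v =
     Inf {norm (v - y) | y. finite (supp e' y) \<and> card (supp e' y) \<le> m \<and> y = proj smul e e' (supp e' y) y}"

definition best_proj_error ::
    "('k::real_normed_field \<Rightarrow> 'a::real_normed_vector \<Rightarrow> 'a) \<Rightarrow> (nat \<Rightarrow> 'a) \<Rightarrow> (nat \<Rightarrow> 'a \<Rightarrow> 'k) \<Rightarrow> nat \<Rightarrow> 'a \<Rightarrow> real" where
  "best_proj_error smul e e' m v =
     Inf {norm (v - proj smul e e' A v) | A. finite A \<and> card A \<le> m}"

definition decreasing_ordering ::
    "(nat \<Rightarrow> 'a \<Rightarrow> 'k::real_normed_field) \<Rightarrow> 'a \<Rightarrow> (nat \<Rightarrow> nat) \<Rightarrow> bool" where
  "decreasing_ordering e' v r \<longleftrightarrow>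
     inj r \<and> supp e' v \<subseteq> range r \<and> (\<forall>i j. i \<le> j \<longrightarrow> norm (e' (r j) v) \<le> norm (e' (r i) v))"

text \<open>
  If the support of \<open>v\<close> is infinite, the conditions below determine the ordering uniquely.  If it
  is finite, the ordering is unique up to the choice of the indices outside the support that are
  listed after it, and one such choice is fixed.  This choice affects neither the greedy sums nor
  the approximations from the span over a greedy set that contains the support.  Existence uses
  bounded coordinates (the coefficients of a vector then tend to 0), which every property
  defined through greedy sets requires.
\<close>

definition greedy_ordering :: "(nat \<Rightarrow> 'a \<Rightarrow> 'k::real_normed_field) \<Rightarrow> 'a \<Rightarrow> nat \<Rightarrow> nat" where
  "greedy_ordering e' v =
     (SOME r. decreasing_ordering e' v r \<and>
        (\<forall>i j. i < j \<and> norm (e' (r i) v) = norm (e' (r j) v) \<longrightarrow> r i < r j))"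

definition greedy_set :: "(nat \<Rightarrow> 'a \<Rightarrow> 'k::real_normed_field) \<Rightarrow> nat \<Rightarrow> 'a \<Rightarrow> nat set" where
  "greedy_set e' m v = greedy_ordering e' v ` {..<m}"

definition greedy_sum ::
    "('k::real_normed_field \<Rightarrow> 'a::real_normed_vector \<Rightarrow> 'a) \<Rightarrow> (nat \<Rightarrow> 'a) \<Rightarrow> (nat \<Rightarrow> 'a \<Rightarrow> 'k) \<Rightarrow> nat \<Rightarrow> 'a \<Rightarrow> 'a" where
  "greedy_sum smul e e' m v = proj smul e e' (greedy_set e' m v) v"

definition almost_greedy ::
    "('k::real_normed_field \<Rightarrow> 'a::real_normed_vector \<Rightarrow> 'a) \<Rightarrow> (nat \<Rightarrow> 'a) \<Rightarrow> (nat \<Rightarrow> 'a \<Rightarrow> 'k) \<Rightarrow> bool" where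
  "almost_greedy smul e e' \<longleftrightarrow> bounded_coordinates e' \<and>
     (\<exists>M>0. \<forall>v m. norm (v - greedy_sum smul e e' m v) \<le> M * best_proj_error smul e e' m v)"

definition semi_greedy ::
    "('k::real_normed_field \<Rightarrow> 'a::real_normed_vector \<Rightarrow> 'a) \<Rightarrow> (nat \<Rightarrow> 'a) \<Rightarrow> (nat \<Rightarrow> 'a \<Rightarrow> 'k) \<Rightarrow> bool" where
  "semi_greedy smul e e' \<longleftrightarrow> bounded_coordinates e' \<and>
     (\<exists>M>0. \<forall>v. \<forall>m\<ge>1. \<exists>z \<in> module.span smul (e ` greedy_set e' m v).
        norm (v - z) \<le> M * best_error smul e e' m v)"

definition weak_thresholding_set ::
    "(nat \<Rightarrow> 'a \<Rightarrow> 'k::real_normed_field) \<Rightarrow> real \<Rightarrow> 'a \<Rightarrow> nat \<Rightarrow> nat set \<Rightarrow> bool" where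
  "weak_thresholding_set e' \<tau> v m W \<longleftrightarrow> finite W \<and> card W = m \<and>
     (\<forall>i\<in>W. \<forall>j. j \<notin> W \<longrightarrow> norm (e' i v) \<ge> \<tau> * norm (e' j v))"

definition WAG ::
    "('k::real_normed_field \<Rightarrow> 'a::real_normed_vector \<Rightarrow> 'a) \<Rightarrow> (nat \<Rightarrow> 'a) \<Rightarrow> (nat \<Rightarrow> 'a \<Rightarrow> 'k) \<Rightarrow> real \<Rightarrow> bool" where
  "WAG smul e e' \<tau> \<longleftrightarrow>
     (\<exists>M>0. \<forall>v. \<forall>m\<ge>1. \<exists>W. weak_thresholding_set e' \<tau> v m W \<and>
        norm (v - proj smul e e' W v) \<le> M * best_proj_error smul e e' m v)"

definition WSG ::
    "('k::real_normed_field \<Rightarrow> 'a::real_normed_vector \<Rightarrow> 'a) \<Rightarrow> (nat \<Rightarrow> 'a) \<Rightarrow> (nat \<Rightarrow> 'a \<Rightarrow> 'k) \<Rightarrow> real \<Rightarrow> bool" where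
  "WSG smul e e' \<tau> \<longleftrightarrow>
     (\<exists>M>0. \<forall>v. \<forall>m\<ge>1. \<exists>W. weak_thresholding_set e' \<tau> v m W \<and>
        (\<exists>z \<in> module.span smul (e ` W). norm (v - z) \<le> M * best_error smul e e' m v))"

end

theory Submission
  imports Defs "HOL-Library.Ramsey"
begin

text \<open>
  All six properties are compared with one pair of inequalities for the coordinates of a
  vector.

  \<^item> \<open>thresholding_bound K\<close>: removing from \<open>v\<close> its coordinates in a set \<open>F\<close> on which the coefficients
    are largest costs at most a factor \<open>K\<close> (the basis is quasi-greedy).
  \<^item> \<open>dominance_bound C\<close>: if \<open>v\<close> has at least as many coefficients of modulus at least \<open>\<alpha>\<close> as a finite
    sum has terms, all with coefficients of modulus at most \<open>\<alpha>\<close>, then the norm of the sum is at most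
    \<open>C\<close> times the norm of \<open>v\<close> (a form of democracy).

  With bounded coordinates these two inequalities give both strong properties. For almost
  greediness, let \<open>w = v - P B v\<close> for a competing projection. Then \<open>v - P A v\<close> arises from \<open>w\<close>
  by removing the coordinates in \<open>A - B\<close>, a thresholding set of \<open>w\<close>, and restoring those of \<open>v\<close>
  in \<open>B - A\<close>, which are dominated by the coordinates of \<open>w\<close> in \<open>A - B\<close> (\<open>almost_greedyI\<close>). For
  semi-greediness, \<open>w = v - y\<close> for a competitor \<open>y\<close>; after the large coefficients of \<open>w\<close> have
  been removed, only coordinates outside the greedy set have to be corrected, and these
  corrections are again dominated by \<open>w\<close> (\<open>greedy_span_approximation\<close>).

  Conversely, each weak property yields the two inequalities. The device is to add a second
  vector of disjoint support, with coefficients so large that every weak thresholding set of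
  the sum must coincide with that support, or so small that it must avoid that support; the
  approximation property of the sum then compares the norms of the two summands. For WAG this
  works at once (\<open>WAG_flat_comparison\<close>, \<open>WAG_bounds\<close>). For WSG the approximant may have
  arbitrary coefficients on the thresholding set, so the property only bounds the distance to
  the span of the basis vectors with indices in the support \<open>G\<close> of the added vector. A bound on
  the norm follows if \<open>G\<close> is \<open>separated\<close> from the support of the vector under study, that is,
  if \<open>norm x \<le> C * norm (x + y)\<close> whenever \<open>x\<close> is supported in the latter and \<open>y\<close> in \<open>G\<close>, with a
  universal constant \<open>C\<close>.

  The existence of such sets \<open>G\<close> (\<open>far_sets_separated\<close>) is the heart of the proof and rests on
  the totality of the coordinate functionals. If no set of \<open>m\<close> indices from some infinite set
  were separated with constant \<open>1 / \<epsilon>\<close>, Ramsey's theorem would provide an infinite subset \<open>N\<close>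
  and one unit vector \<open>x\<close> that is approximated up to \<open>2 * \<epsilon>\<close> by a combination of any \<open>m\<close> basis
  vectors with indices in \<open>N\<close>, always with the same coefficients in increasing order of the
  indices. Averaging over shifted windows, only the sum of these coefficients matters, so the
  Cesaro means of the basis vectors along \<open>N\<close> stay within relative distance \<open>3 * \<epsilon>\<close> of a fixed
  nonzero vector. If separation failed in this way for every constant and inside every infinite
  set, then along a diagonal sequence these means would form a Cauchy sequence. All coordinates
  of its limit vanish, so the limit is 0 by totality; but the limit also lies within distance
  \<open>3 / 4 * norm u\<close> of some \<open>u \<noteq> 0\<close>, which is absurd.

  Bounded coordinates themselves follow from the mere existence of weak thresholding sets of
  cardinality 1 and the Baire category theorem (\<open>bounded_coordinates_of_weak_thresholding\<close>).
\<close>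

section \<open>Coordinates with respect to a Markushevich basis\<close>

locale M_basis = banach_space_over smul
  for smul :: "'k::{real_normed_field, euclidean_space} \<Rightarrow> 'a::banach \<Rightarrow> 'a" +
  fixes e :: "nat \<Rightarrow> 'a" and e' :: "nat \<Rightarrow> 'a \<Rightarrow> 'k"
  assumes markushevich: "markushevich_basis smul e e'"
begin

abbreviation P :: "nat set \<Rightarrow> 'a \<Rightarrow> 'a" where
  "P \<equiv> proj smul e e'"

definition comb :: "nat set \<Rightarrow> (nat \<Rightarrow> 'k) \<Rightarrow> 'a" where
  "comb A a = (\<Sum>i\<in>A. smul (a i) (e i))"

lemma proj_eq_comb: "P A v = comb A (\<lambda>i. e' i v)"
  by (simp add: proj_def comb_def)

lemma coord_linear: "Vector_Spaces.linear smul (*) (e' i)" and coord_bounded_linear: "bounded_linear (e' i)"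
  using markushevich by (auto simp: markushevich_basis_def dual_space_def)

lemma coord_smul [simp]: "e' i (smul c v) = c * e' i v"
  using coord_linear[of i] by (simp add: Vector_Spaces.linear_iff)

lemmas coord_add [simp] = linear_add[OF bounded_linear.linear[OF coord_bounded_linear]]
  and coord_diff [simp] = linear_diff[OF bounded_linear.linear[OF coord_bounded_linear]]
  and coord_zero [simp] = linear_0[OF bounded_linear.linear[OF coord_bounded_linear]]
  and coord_sum = linear_sum[OF bounded_linear.linear[OF coord_bounded_linear]]
  and coord_scaleR [simp] = linear_scale[OF bounded_linear.linear[OF coord_bounded_linear]]

lemma coord_basis [simp]: "e' i (e j) = (if i = j then 1 else 0)"
  using markushevich by (auto simp: markushevich_basis_def)

lemma total: "(\<And>i. e' i v = 0) \<Longrightarrow> v = 0"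
  using markushevich by (auto simp: markushevich_basis_def)

lemma coord_comb: "finite A \<Longrightarrow> e' j (comb A a) = (if j \<in> A then a j else 0)"
  by (simp add: comb_def coord_sum if_distrib sum.delta cong: if_cong)

lemma coord_proj: "finite A \<Longrightarrow> e' j (P A v) = (if j \<in> A then e' j v else 0)"
  by (simp add: proj_eq_comb coord_comb)

lemma comb_cong: "(\<And>i. i \<in> A \<Longrightarrow> a i = b i) \<Longrightarrow> comb A a = comb A b"
  by (simp add: comb_def)

lemma proj_comb: "finite A \<Longrightarrow> P A (comb A a) = comb A a"
  by (auto simp: proj_eq_comb coord_comb intro: comb_cong)

lemma proj_cong: "(\<And>i. i \<in> A \<Longrightarrow> e' i v = e' i w) \<Longrightarrow> P A v = P A w"
  by (simp add: proj_def)

lemma proj_add: "P A (v + w) = P A v + P A w"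
  by (simp add: proj_def scale_left_distrib sum.distrib)

lemma proj_diff: "P A (v - w) = P A v - P A w"
  by (simp add: proj_def scale_left_diff_distrib sum_subtractf)

lemma proj_smul: "P A (smul c v) = smul c (P A v)"
  by (simp add: proj_def scale_sum_right)

lemma proj_zero: "P A 0 = 0"
  by (simp add: proj_def)

lemma proj_union: "finite A \<Longrightarrow> finite B \<Longrightarrow> A \<inter> B = {} \<Longrightarrow> P (A \<union> B) v = P A v + P B v"
  by (simp add: proj_def sum.union_disjoint)

lemma proj_split: "finite A \<Longrightarrow> P A v = P (A \<inter> B) v + P (A - B) v"
  by (simp add: proj_def sum.Int_Diff)

lemma proj_proj: "finite A \<Longrightarrow> finite B \<Longrightarrow> P A (P B v) = P (A \<inter> B) v"
  by (simp add: proj_def[of _ _ _ A] coord_proj proj_def[of _ _ _ "A \<inter> B"] sum.inter_restrict if_distrib[of "\<lambda>c. smul c _"] cong: if_cong)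

lemma proj_fixed_mono:
  assumes "P A v = v" "A \<subseteq> B" "finite B"
  shows "P B v = v"
  using assms proj_proj[of B A v] finite_subset[of A B] by (simp add: Int_absorb1)

lemma coord_outside: "P A v = v \<Longrightarrow> finite A \<Longrightarrow> j \<notin> A \<Longrightarrow> e' j v = 0"
  using coord_proj[of A j v] by simp

lemma proj_supp: "P A v = v \<Longrightarrow> finite A \<Longrightarrow> P (supp e' v) v = v"
proof -
  assume a: "P A v = v" "finite A"
  then have "supp e' v \<subseteq> A" using coord_outside by (auto simp: supp_def)
  then have "P A v = P (supp e' v) v"
    unfolding proj_def using a(2) by (intro sum.mono_neutral_right) (auto simp: supp_def)
  then show ?thesis using a by simp
qed

lemma smul_scaleR: "smul c (r *\<^sub>R v) = r *\<^sub>R smul c v"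
  by (metis mult.commute scale_scale smul_of_real)

lemma proj_scaleR: "P A (r *\<^sub>R v) = r *\<^sub>R P A v"
  using proj_smul[of A "of_real r" v] by (simp add: smul_of_real)

lemma comb_diff: "comb A a - comb A b = comb A (\<lambda>i. a i - b i)"
  by (simp add: comb_def scale_left_diff_distrib sum_subtractf)

lemma smul_tendsto_zero: "(f \<longlongrightarrow> 0) F \<Longrightarrow> ((\<lambda>n. smul c (f n)) \<longlongrightarrow> 0) F"
  by (rule tendsto_norm_zero_cancel) (simp add: norm_smul tendsto_mult_right_zero tendsto_norm_zero)

lemma norm_comb_le:
  assumes "\<And>i. i \<in> A \<Longrightarrow> norm (a i) \<le> r"
  shows "norm (comb A a) \<le> r * (\<Sum>i\<in>A. norm (e i))"
  unfolding comb_def sum_distrib_left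
  by (rule sum_norm_le) (simp add: norm_smul assms mult_right_mono)

lemma smul_tendsto:
  assumes "(f \<longlongrightarrow> c) F"
  shows "((\<lambda>n. smul (f n) v) \<longlongrightarrow> smul c v) F"
proof (rule metric_tendsto_imp_tendsto)
  show "((\<lambda>n. f n * of_real (norm v)) \<longlongrightarrow> c * of_real (norm v)) F"
    by (intro tendsto_intros assms)
  show "\<forall>\<^sub>F n in F. dist (smul (f n) v) (smul c v) \<le> dist (f n * of_real (norm v)) (c * of_real (norm v))"
    by (simp add: dist_norm norm_smul norm_mult flip: scale_left_diff_distrib left_diff_distrib)
qed

lemma coord_tendsto: "(f \<longlongrightarrow> v) F \<Longrightarrow> ((\<lambda>n. e' i (f n)) \<longlongrightarrow> e' i v) F"
  by (rule bounded_linear.tendsto[OF coord_bounded_linear])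

lemma proj_tendsto: "(f \<longlongrightarrow> v) F \<Longrightarrow> ((\<lambda>n. P A (f n)) \<longlongrightarrow> P A v) F"
  unfolding proj_def by (intro tendsto_sum smul_tendsto coord_tendsto)

text \<open>
  Biorthogonality makes the projection a membership test for the span, so that finitely supported
  vectors can be handled below as fixed points of projections.
\<close>

lemma in_span_iff:
  assumes "finite A"
  shows "z \<in> span (e ` A) \<longleftrightarrow> P A z = z"
proof
  assume "P A z = z"
  moreover have "P A z \<in> span (e ` A)"
    unfolding proj_def by (intro span_sum span_scale span_base) auto
  ultimately show "z \<in> span (e ` A)" by simp
next
  have "P A (e i) = e i" if "i \<in> A" for i
    using that assms by (simp add: proj_def if_distrib[of "\<lambda>c. smul c _"] sum.delta cong: if_cong)
  moreover have "subspace {z. P A z = z}"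
    by (auto simp: subspace_def proj_zero proj_add proj_smul)
  ultimately have "span (e ` A) \<subseteq> {z. P A z = z}"
    by (intro span_minimal) auto
  then show "z \<in> span (e ` A) \<Longrightarrow> P A z = z" by auto
qed

text \<open>
  The only use of the density of the span; it replaces a general vector by a finitely supported one.
\<close>

lemma finitely_supported_dense:
  assumes "\<delta> > 0"
  obtains A w where "finite A" "P A w = w" "norm (v - w) < \<delta>"
proof -
  have "subspace {z. \<exists>A. finite A \<and> P A z = z}"
    unfolding subspace_def
  proof (safe)
    show "\<exists>A. finite A \<and> P A 0 = 0" by (auto simp: proj_zero)
    show "\<exists>A. finite A \<and> P A (smul c x) = smul c x" if "finite A" "P A x = x" for A c x
      using that by (metis proj_smul)
    show "\<exists>C. finite C \<and> P C (x + y) = x + y"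
      if "finite A" "P A x = x" "finite B" "P B y = y" for x y A B
      using that by (intro exI[of _ "A \<union> B"])
        (auto simp: proj_add proj_fixed_mono[of A x "A \<union> B"] proj_fixed_mono[of B y "A \<union> B"])
  qed
  moreover have "finite {i}" "P {i} (e i) = e i" for i
    by (auto simp: proj_def)
  ultimately have "span (range e) \<subseteq> {z. \<exists>A. finite A \<and> P A z = z}"
    by (intro span_minimal) blast+
  moreover have "v \<in> closure (span (range e))"
    using markushevich by (simp add: markushevich_basis_def)
  then obtain w where "w \<in> span (range e)" "norm (v - w) < \<delta>"
    using \<open>\<delta> > 0\<close> unfolding closure_approachable dist_norm by (metis norm_minus_commute)
  ultimately show thesis using that by blast
qed

section \<open>Best approximation errors\<close>

lemma best_error_le:
  assumes "finite A" "card A \<le> m" "P A y = y"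
  shows "best_error smul e e' m v \<le> norm (v - y)"
proof -
  have "supp e' y \<subseteq> A" using assms coord_outside by (auto simp: supp_def)
  then have "finite (supp e' y)" "card (supp e' y) \<le> m"
    using assms(1,2) finite_subset[of "supp e' y" A] card_mono[of A "supp e' y"] by auto
  then show ?thesis
    unfolding best_error_def using proj_supp[OF assms(3,1)]
    by (intro cInf_lower bdd_belowI[of _ 0]) (auto intro!: exI[of _ y])
qed

lemma best_error_ge:
  assumes "\<And>A y. finite A \<Longrightarrow> card A \<le> m \<Longrightarrow> P A y = y \<Longrightarrow> r \<le> norm (v - y)"
  shows "r \<le> best_error smul e e' m v"
  unfolding best_error_def
proof (rule cInf_greatest)
  have "supp e' 0 = {}" by (simp add: supp_def)
  then show "{norm (v - y) |y. finite (supp e' y) \<and> card (supp e' y) \<le> m \<and> y = P (supp e' y) y} \<noteq> {}"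
    by (auto intro!: exI[of _ 0] simp: proj_def)
qed (use assms in force)

lemma best_proj_error_le:
  "finite A \<Longrightarrow> card A \<le> m \<Longrightarrow> best_proj_error smul e e' m v \<le> norm (v - P A v)"
  unfolding best_proj_error_def by (intro cInf_lower bdd_belowI[of _ 0]) auto

lemma best_proj_error_ge:
  assumes "\<And>A. finite A \<Longrightarrow> card A \<le> m \<Longrightarrow> r \<le> norm (v - P A v)"
  shows "r \<le> best_proj_error smul e e' m v"
  unfolding best_proj_error_def
proof (rule cInf_greatest)
  have "finite {} \<and> card ({} :: nat set) \<le> m" by simp
  then show "{norm (v - P A v) |A. finite A \<and> card A \<le> m} \<noteq> {}" by blast
qed (use assms in blast)

section \<open>Bounded coordinates\<close>

lemma bounded_coordinates_iff:
  "bounded_coordinates e' \<longleftrightarrow> (\<exists>c>0. \<forall>i v. norm (e' i v) \<le> c * norm v)"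
proof
  assume "bounded_coordinates e'"
  then obtain c where c: "\<And>i. onorm (e' i) \<le> c"
    unfolding bounded_coordinates_def bdd_above_def by auto
  have "norm (e' i v) \<le> max c 1 * norm v" for i v
  proof -
    have "norm (e' i v) \<le> onorm (e' i) * norm v" by (rule onorm[OF coord_bounded_linear])
    also have "\<dots> \<le> max c 1 * norm v" using c[of i] by (intro mult_right_mono) auto
    finally show ?thesis .
  qed
  then show "\<exists>c>0. \<forall>i v. norm (e' i v) \<le> c * norm v"
    by (intro exI[of _ "max c 1"]) auto
next
  assume "\<exists>c>0. \<forall>i v. norm (e' i v) \<le> c * norm v"
  then obtain c where "c > 0" and c: "\<And>i v. norm (e' i v) \<le> c * norm v" by blast
  then have "onorm (e' i) \<le> c" for i
    by (intro onorm_bound) auto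
  then show "bounded_coordinates e'"
    unfolding bounded_coordinates_def bdd_above_def by auto
qed

text \<open>
  The coordinates of a vector tend to 0: they are uniformly close to those of a finitely supported
  approximation.
\<close>

lemma finite_large_coordinates:
  assumes "bounded_coordinates e'" "\<alpha> > 0"
  shows "finite {i. \<alpha> \<le> norm (e' i v)}"
proof -
  obtain c where "c > 0" and c: "\<And>i v. norm (e' i v) \<le> c * norm v"
    using assms(1) bounded_coordinates_iff by blast
  obtain A w where w: "finite A" "P A w = w" "norm (v - w) < \<alpha> / c"
    using finitely_supported_dense[of "\<alpha> / c" v] assms \<open>c > 0\<close> by auto
  have "norm (e' i v) < \<alpha>" if "i \<notin> A" for i
  proof -
    have "e' i v = e' i (v - w)" using coord_outside[OF w(2,1) that] by simp
    also have "norm \<dots> \<le> c * norm (v - w)" by (rule c)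
    also have "\<dots> < \<alpha>" using w(3) \<open>c > 0\<close> by (simp add: field_simps)
    finally show ?thesis .
  qed
  then have "{i. \<alpha> \<le> norm (e' i v)} \<subseteq> A" by force
  then show ?thesis using w(1) finite_subset by blast
qed

text \<open>
  The uniform boundedness principle for the coordinate functionals: by Baire's theorem, some set on
  which all coordinates are bounded by a fixed \<open>n\<close> contains a ball.
\<close>

lemma bounded_coordinates_of_pointwise:
  assumes "\<And>v. bdd_above (range (\<lambda>i. norm (e' i v)))"
  shows "bounded_coordinates e'"
proof -
  define T where "T n = {v. \<forall>i. norm (e' i v) \<le> real n}" for n
  have cl: "closed (T n)" for n
    unfolding T_def Collect_all_eq
    by (intro closed_INT ballI closed_Collect_le continuous_on_norm continuous_on_const
        linear_continuous_on coord_bounded_linear)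
  have "\<Union> (range T) = UNIV"
  proof -
    have "\<exists>n. v \<in> T n" for v
    proof -
      obtain r where "\<And>i. norm (e' i v) \<le> r" using assms[of v] by (auto simp: bdd_above_def)
      moreover obtain n where "r \<le> real n" using real_arch_simple by blast
      ultimately show ?thesis unfolding T_def using order_trans by blast
    qed
    then show ?thesis by blast
  qed
  moreover have "interior (\<Union> (range T)) = {}" if "\<And>n. interior (T n) = {}"
  proof -
    have "Met_TC.mtopology interior_of \<Union> (range T) = {}"
      by (rule Met_TC.metric_Baire_category_alt) (use cl that in auto)
    then show ?thesis by simp
  qed
  ultimately obtain n where "interior (T n) \<noteq> {}" using interior_UNIV UNIV_not_empty by force
  then obtain u where "u \<in> interior (T n)" by blast
  then obtain r where "r > 0" and u: "ball u r \<subseteq> T n"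
    unfolding mem_interior by blast
  have "norm (e' i v) \<le> (4 * real n / r) * norm v" for i v
  proof (cases "v = 0")
    case False
    define s where "s = r / (2 * norm v)"
    have s: "s > 0" using False \<open>r > 0\<close> by (simp add: s_def)
    have "u + s *\<^sub>R v \<in> ball u r" "u \<in> ball u r"
      using False \<open>r > 0\<close> by (auto simp: s_def dist_norm)
    then have "norm (e' i (u + s *\<^sub>R v)) \<le> n" "norm (e' i u) \<le> n" using u unfolding T_def by blast+
    then have "norm (e' i (s *\<^sub>R v)) \<le> 2 * n"
      using norm_triangle_ineq4[of "e' i (u + s *\<^sub>R v)" "e' i u"] by simp
    then show ?thesis using s False \<open>r > 0\<close> by (simp add: s_def field_simps)
  qed simp
  then have "norm (e' i v) \<le> (4 * real n / r + 1) * norm v" for i v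
    using norm_ge_zero[of v] by (simp add: distrib_right add_increasing2)
  then show ?thesis
    unfolding bounded_coordinates_iff using \<open>r > 0\<close>
    by (intro exI[of _ "4 * real n / r + 1"]) (auto intro!: add_nonneg_pos)
qed

section \<open>Thresholding sets and the greedy ordering\<close>

lemma weak_thresholding_set_mono:
  assumes "weak_thresholding_set e' \<tau> v m W" "\<tau>' \<le> \<tau>"
  shows "weak_thresholding_set e' \<tau>' v m W"
  using assms unfolding weak_thresholding_set_def
  by (meson mult_right_mono norm_ge_zero order_trans)

text \<open>
  If \<open>i \<in> W\<close> does not belong to \<open>F\<close>, some \<open>j \<in> F\<close> was left out of \<open>W\<close> because the cardinalities agree, and
  \<open>W\<close> preferred \<open>i\<close> to \<open>j\<close>.
\<close>

lemma weak_thresholding_set_large: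
  assumes W: "weak_thresholding_set e' \<tau> v m W" and "finite F" "card F = m"
    and large: "\<And>j. j \<in> F \<Longrightarrow> \<alpha> \<le> norm (e' j v)"
    and "0 < \<tau>" "\<tau> \<le> 1" "0 \<le> \<alpha>" "i \<in> W"
  shows "\<tau> * \<alpha> \<le> norm (e' i v)"
proof (cases "i \<in> F")
  case True
  have "\<tau> * \<alpha> \<le> 1 * \<alpha>" using assms by (intro mult_right_mono)
  then show ?thesis using large[OF True] by simp
next
  case False
  have "\<not> F \<subseteq> W"
  proof
    assume "F \<subseteq> W"
    then have "F \<subset> W" using False \<open>i \<in> W\<close> by blast
    then have "card F < card W" using W psubset_card_mono by (auto simp: weak_thresholding_set_def)
    then show False using W \<open>card F = m\<close> by (simp add: weak_thresholding_set_def)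
  qed
  then obtain j where j: "j \<in> F" "j \<notin> W" by blast
  have "\<tau> * \<alpha> \<le> \<tau> * norm (e' j v)" using large[OF j(1)] \<open>0 < \<tau>\<close> by simp
  also have "\<dots> \<le> norm (e' i v)" using W j \<open>i \<in> W\<close> by (auto simp: weak_thresholding_set_def)
  finally show ?thesis .
qed

lemma weak_thresholding_set_unique:
  assumes W: "weak_thresholding_set e' \<tau> v m W" and G: "finite G" "card G = m"
    and large: "\<And>j. j \<in> G \<Longrightarrow> \<alpha> \<le> norm (e' j v)"
    and small: "\<And>j. j \<notin> G \<Longrightarrow> norm (e' j v) < \<tau> * \<alpha>"
    and "0 < \<tau>" "\<tau> \<le> 1" "0 \<le> \<alpha>"
  shows "W = G"
proof -
  have "W \<subseteq> G" using weak_thresholding_set_large[OF W G large] small assms(6-8) by force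
  then show ?thesis using W G by (simp add: weak_thresholding_set_def card_subset_eq)
qed

text \<open>
  The ordering repeatedly picks the smallest index among those of maximal modulus that are still
  available.  A maximum exists because the coordinates tend to 0, and for the same reason no index of
  the support is postponed forever.
\<close>

lemma greedy_ordering_exists:
  assumes "bounded_coordinates e'"
  shows "\<exists>r. decreasing_ordering e' v r \<and>
    (\<forall>i j. i < j \<and> norm (e' (r i) v) = norm (e' (r j) v) \<longrightarrow> r i < r j)"
proof -
  (* the admissible choices once the indices in A have been listed *)
  define best where "best A i \<longleftrightarrow> i \<notin> A \<and> (\<forall>j. j \<notin> A \<longrightarrow> norm (e' j v) \<le> norm (e' i v))" for A i
  define pick where "pick A = (LEAST i. best A i)" for A
  have ex: "\<exists>i. best A i" if "finite A" for A
  proof (cases "\<exists>j. j \<notin> A \<and> e' j v \<noteq> 0")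
    case True
    then obtain j where j: "j \<notin> A" "e' j v \<noteq> 0" by blast
    define S where "S = {i. norm (e' j v) \<le> norm (e' i v)} - A"
    have S: "finite S" "j \<in> S"
      using finite_large_coordinates[OF assms, of "norm (e' j v)" v] j by (auto simp: S_def)
    have "Max ((\<lambda>i. norm (e' i v)) ` S) \<in> (\<lambda>i. norm (e' i v)) ` S"
      using S by (intro Max_in) auto
    then obtain i where i: "i \<in> S" "norm (e' i v) = Max ((\<lambda>i. norm (e' i v)) ` S)" by auto
    have "norm (e' k v) \<le> norm (e' i v)" if "k \<notin> A" for k
    proof (cases "k \<in> S")
      case True
      then show ?thesis using S i(2) by auto
    next
      case False
      then have "norm (e' k v) < norm (e' j v)" using that by (auto simp: S_def)
      also have "\<dots> \<le> norm (e' i v)" using i(1) by (simp add: S_def)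
      finally show ?thesis by simp
    qed
    then show ?thesis using i(1) by (auto simp: best_def S_def)
  next
    case False
    obtain i where "i \<notin> A" using ex_new_if_finite[OF infinite_UNIV_nat \<open>finite A\<close>] by blast
    then have "best A i" using False by (auto simp: best_def)
    then show ?thesis by blast
  qed
  define G where "G = rec_nat {} (\<lambda>_ A. insert (pick A) A)"
  define r where "r n = pick (G n)" for n
  have G: "G 0 = {}" "G (Suc n) = insert (r n) (G n)" for n by (auto simp: G_def r_def)
  have fin: "finite (G n)" for n by (induction n) (auto simp: G)
  have best: "best (G n) (r n)" for n
    unfolding r_def pick_def using ex[OF fin] by (rule LeastI_ex)
  have mono: "G i \<subseteq> G j" if "i \<le> j" for i j
    using that by (induction rule: dec_induct) (auto simp: G)
  have G_mem: "r i \<in> G j" if "i < j" for i j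
    using mono[of "Suc i" j] that by (auto simp: G)
  have neq: "r i \<noteq> r j" if "i < j" for i j
    using G_mem[OF that] best[of j] by (auto simp: best_def)
  then have inj: "inj r" by (metis linorder_neqE_nat injI)
  have notin: "r j \<notin> G i" if "i \<le> j" for i j
    using mono[OF that] best[of j] by (auto simp: best_def)
  have dec: "norm (e' (r j) v) \<le> norm (e' (r i) v)" if "i \<le> j" for i j
    using notin[OF that] best[of i] by (auto simp: best_def)
  have G_range: "G n \<subseteq> range r" for n by (induction n) (auto simp: G)
  have "k \<in> range r" if "k \<in> supp e' v" for k
  proof (rule ccontr)
    assume k: "k \<notin> range r"
    then have "norm (e' k v) \<le> norm (e' (r n) v)" for n
      using best[of n] G_range[of n] by (auto simp: best_def)
    then have "range r \<subseteq> {i. norm (e' k v) \<le> norm (e' i v)}" by auto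
    moreover have "finite {i. norm (e' k v) \<le> norm (e' i v)}"
      using that assms by (intro finite_large_coordinates) (auto simp: supp_def)
    ultimately have "finite (range r)" using finite_subset by blast
    then show False using inj finite_imageD by blast
  qed
  moreover have "r i < r j" if "i < j" "norm (e' (r i) v) = norm (e' (r j) v)" for i j
  proof -
    have "best (G i) (r j)"
      using notin[of i j] that best[of i] by (auto simp: best_def)
    then have "r i \<le> r j" unfolding r_def[of i] pick_def by (rule Least_le)
    then show ?thesis using neq[OF that(1)] by simp
  qed
  ultimately show ?thesis using inj dec by (auto simp: decreasing_ordering_def)
qed

lemma greedy_set_thresholding:
  assumes "bounded_coordinates e'"
  shows "weak_thresholding_set e' 1 v m (greedy_set e' m v)"
proof -
  define r where "r = greedy_ordering e' v"
  have r: "decreasing_ordering e' v r"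
    using someI_ex[OF greedy_ordering_exists[OF assms, of v]]
    unfolding r_def greedy_ordering_def by blast
  then have inj: "inj r" and dec: "\<And>i j. i \<le> j \<Longrightarrow> norm (e' (r j) v) \<le> norm (e' (r i) v)"
    and supp: "supp e' v \<subseteq> range r"
    by (auto simp: decreasing_ordering_def)
  have "norm (e' j v) \<le> norm (e' (r i) v)" if "i < m" "j \<notin> r ` {..<m}" for i j
  proof (cases "j \<in> supp e' v")
    case True
    then obtain k where k: "j = r k" using supp by auto
    then have "i \<le> k" using that by (metis image_eqI lessThan_iff linorder_not_less order_less_imp_le order_less_le_trans)
    then show ?thesis using dec k by simp
  qed (simp add: supp_def)
  then show ?thesis
    unfolding weak_thresholding_set_def greedy_set_def r_def[symmetric]
    using inj by (auto simp: card_image inj_on_subset)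
qed

text \<open>
  A weak thresholding set with one element \<open>i\<close> bounds all coordinates of \<open>v\<close> by a multiple of the \<open>i\<close>-th.
\<close>

lemma bounded_coordinates_of_weak_thresholding:
  assumes "0 < \<tau>" "\<And>v. \<exists>W. weak_thresholding_set e' \<tau> v 1 W"
  shows "bounded_coordinates e'"
proof (rule bounded_coordinates_of_pointwise)
  fix v
  obtain W where W: "weak_thresholding_set e' \<tau> v 1 W" using assms by blast
  then obtain i where i: "W = {i}" by (auto simp: weak_thresholding_set_def card_1_singleton_iff)
  have "norm (e' j v) \<le> max (norm (e' i v)) (norm (e' i v) / \<tau>)" for j
  proof (cases "j = i")
    case False
    then have "\<tau> * norm (e' j v) \<le> norm (e' i v)"
      using W i by (auto simp: weak_thresholding_set_def)
    then have "norm (e' j v) \<le> norm (e' i v) / \<tau>"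
      using \<open>0 < \<tau>\<close> by (simp add: field_simps)
    then show ?thesis by simp
  qed simp
  then show "bdd_above (range (\<lambda>j. norm (e' j v)))" by (auto simp: bdd_above_def)
qed

section \<open>Two inequalities sufficient for the greedy properties\<close>

definition thresholding_bound :: "real \<Rightarrow> bool" where
  "thresholding_bound K \<longleftrightarrow> 0 \<le> K \<and>
     (\<forall>v F. weak_thresholding_set e' 1 v (card F) F \<longrightarrow> norm (v - P F v) \<le> K * norm v)"

definition dominance_bound :: "real \<Rightarrow> bool" where
  "dominance_bound C \<longleftrightarrow> 0 \<le> C \<and>
     (\<forall>E F a v \<alpha>. finite E \<and> finite F \<and> card E \<le> card F \<and>
        (\<forall>i\<in>E. norm (a i) \<le> \<alpha>) \<and> (\<forall>i\<in>F. \<alpha> \<le> norm (e' i v)) \<longrightarrow>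
        norm (comb E a) \<le> C * norm v)"

lemma thresholding_boundD:
  "thresholding_bound K \<Longrightarrow> weak_thresholding_set e' 1 v m F \<Longrightarrow> norm (v - P F v) \<le> K * norm v"
  by (auto simp: thresholding_bound_def weak_thresholding_set_def)

lemma dominance_boundD:
  assumes "dominance_bound C" "finite E" "finite F" "card E \<le> card F"
    "\<And>i. i \<in> E \<Longrightarrow> norm (a i) \<le> \<alpha>" "\<And>i. i \<in> F \<Longrightarrow> \<alpha> \<le> norm (e' i v)"
  shows "norm (comb E a) \<le> C * norm v"
  using assms unfolding dominance_bound_def by blast

text \<open>
  The smallest modulus on the thresholding set serves as the level.
\<close>

lemma threshold_level:
  assumes W: "weak_thresholding_set e' 1 v m W" and "m \<ge> 1"
  obtains \<alpha> where "\<alpha> \<ge> 0" "\<And>i. i \<in> W \<Longrightarrow> \<alpha> \<le> norm (e' i v)"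
    "\<And>i. i \<notin> W \<Longrightarrow> norm (e' i v) \<le> \<alpha>"
proof -
  have fin: "finite W" "W \<noteq> {}" using assms by (auto simp: weak_thresholding_set_def)
  define \<alpha> where "\<alpha> = Min ((\<lambda>i. norm (e' i v)) ` W)"
  have "\<alpha> \<in> (\<lambda>i. norm (e' i v)) ` W" unfolding \<alpha>_def using fin by (intro Min_in) auto
  then have "\<alpha> \<ge> 0" "\<And>i. i \<notin> W \<Longrightarrow> norm (e' i v) \<le> \<alpha>"
    using W by (auto simp: weak_thresholding_set_def)
  moreover have "\<alpha> \<le> norm (e' i v)" if "i \<in> W" for i
    unfolding \<alpha>_def using fin that by auto
  ultimately show thesis using that by blast
qed

lemma proj_eq_if_zero_outside:
  assumes "finite A" "\<And>i. i \<notin> A \<Longrightarrow> e' i v = 0"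
  shows "P A v = v"
proof -
  have "P A v - v = 0" by (rule total) (use assms in \<open>simp add: coord_proj\<close>)
  then show ?thesis by simp
qed

text \<open>
  Thresholding sets at level 0 contain the whole support and leave no remainder, so that only
  positive levels matter.
\<close>

lemma thresholding_boundI:
  assumes "1 \<le> K"
    and main: "\<And>v F \<alpha>. finite F \<Longrightarrow> card F \<ge> 1 \<Longrightarrow> \<alpha> > 0 \<Longrightarrow> (\<And>i. i \<in> F \<Longrightarrow> \<alpha> \<le> norm (e' i v)) \<Longrightarrow>
      (\<And>i. i \<notin> F \<Longrightarrow> norm (e' i v) \<le> \<alpha>) \<Longrightarrow> norm (v - P F v) \<le> K * norm v"
  shows "thresholding_bound K"
proof -
  have "norm (v - P F v) \<le> K * norm v" if F: "weak_thresholding_set e' 1 v (card F) F" for v F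
  proof (cases "card F \<ge> 1")
    case False
    then have "F = {}" using F by (auto simp: weak_thresholding_set_def not_le)
    then show ?thesis using mult_right_mono[OF \<open>1 \<le> K\<close>, of "norm v"] by (simp add: proj_def)
  next
    case True
    have fin: "finite F" using F by (simp add: weak_thresholding_set_def)
    obtain \<alpha> where "\<alpha> \<ge> 0" and large: "\<And>i. i \<in> F \<Longrightarrow> \<alpha> \<le> norm (e' i v)"
      and small: "\<And>i. i \<notin> F \<Longrightarrow> norm (e' i v) \<le> \<alpha>" using threshold_level[OF F True] by metis
    show ?thesis
    proof (cases "\<alpha> = 0")
      case True
      then have "P F v = v" using small fin by (intro proj_eq_if_zero_outside) auto
      then show ?thesis using \<open>1 \<le> K\<close> by simp
    next
      case False
      then show ?thesis using main[OF fin True _ large small] \<open>\<alpha> \<ge> 0\<close> by simp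
    qed
  qed
  then show ?thesis using \<open>1 \<le> K\<close> by (simp add: thresholding_bound_def)
qed

lemma dominance_boundI:
  assumes "0 \<le> C"
    and main: "\<And>E F a v \<alpha>. finite E \<Longrightarrow> finite F \<Longrightarrow> card F \<ge> 1 \<Longrightarrow> card E \<le> card F \<Longrightarrow> \<alpha> > 0 \<Longrightarrow>
      (\<And>i. i \<in> E \<Longrightarrow> norm (a i) \<le> \<alpha>) \<Longrightarrow> (\<And>i. i \<in> F \<Longrightarrow> \<alpha> \<le> norm (e' i v)) \<Longrightarrow>
      norm (comb E a) \<le> C * norm v"
  shows "dominance_bound C"
  unfolding dominance_bound_def
proof (intro conjI allI impI \<open>0 \<le> C\<close>; elim conjE)
  fix E F :: "nat set" and a :: "nat \<Rightarrow> 'k" and v :: 'a and \<alpha> :: real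
  assume E: "finite E" "\<forall>i\<in>E. norm (a i) \<le> \<alpha>" and F: "finite F" "\<forall>i\<in>F. \<alpha> \<le> norm (e' i v)"
    and EF: "card E \<le> card F"
  show "norm (comb E a) \<le> C * norm v"
  proof (cases "\<alpha> > 0 \<and> card F \<ge> 1")
    case True
    then show ?thesis using main[of E F \<alpha> a v] E F EF by blast
  next
    case False
    have "a i = 0" if "i \<in> E" for i
    proof -
      have "card E > 0" using E(1) that by (auto simp: card_gt_0_iff)
      then have "\<alpha> \<le> 0" using False EF by simp
      then show ?thesis using E(2) that norm_le_zero_iff order_trans by blast
    qed
    then have "comb E a = comb E (\<lambda>_. 0)" by (intro comb_cong)
    then show ?thesis using \<open>0 \<le> C\<close> by (simp add: comb_def)
  qed
qed

lemma almost_greedyI: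
  assumes bc: "bounded_coordinates e'" and K: "thresholding_bound K" and C: "dominance_bound C"
  shows "almost_greedy smul e e'"
proof -
  have nonneg: "0 \<le> K" "0 \<le> C" using K C by (auto simp: thresholding_bound_def dominance_bound_def)
  have main: "norm (v - P A v) \<le> (K + C + 1) * norm (v - P B v)"
    if A: "weak_thresholding_set e' 1 v m A" and B: "finite B" "card B \<le> m" for v m A B
  proof -
    define w where "w = v - P B v"
    have fin: "finite A" "card A = m" using A by (auto simp: weak_thresholding_set_def)
    have w: "e' i w = (if i \<in> B then 0 else e' i v)" for i
      using B by (simp add: w_def coord_proj)
    have split: "v - P A v = (w - P (A - B) w) + P (B - A) v"
    proof -
      have "P (A - B) w = P (A - B) v" by (rule proj_cong) (simp add: w)
      moreover have "P A v = P (A \<inter> B) v + P (A - B) v" "P B v = P (B \<inter> A) v + P (B - A) v"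
        using proj_split fin B by blast+
      ultimately show ?thesis by (simp add: w_def Int_commute)
    qed
    have A_B: "norm (e' j v) \<le> norm (e' i v)" if "i \<in> A" "j \<notin> A" for i j
      using A that by (simp add: weak_thresholding_set_def)
    have "weak_thresholding_set e' 1 w (card (A - B)) (A - B)"
      using fin A_B by (auto simp: weak_thresholding_set_def w)
    from thresholding_boundD[OF K this] have 1: "norm (w - P (A - B) w) \<le> K * norm w" .
    have card: "card (B - A) \<le> card (A - B)"
      using B fin by (intro card_le_sym_Diff) auto
    have 2: "norm (P (B - A) v) \<le> C * norm w"
    proof (cases "A - B = {}")
      case True
      have "card (B - A) = 0" using card unfolding True by simp
      then have "B - A = {}" using card_0_eq[OF finite_Diff[OF B(1), of A]] by (rule iffD1[rotated])
      then show ?thesis using nonneg unfolding \<open>B - A = {}\<close> by (simp add: proj_def)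
    next
      case False
      then have "m \<ge> 1" using fin by (metis DiffE One_nat_def Suc_leI card_gt_0_iff empty_iff ex_in_conv)
      then obtain \<alpha> where "\<And>i. i \<in> A \<Longrightarrow> \<alpha> \<le> norm (e' i v)"
        "\<And>i. i \<notin> A \<Longrightarrow> norm (e' i v) \<le> \<alpha>" using threshold_level[OF A] by metis
      then show ?thesis
        unfolding proj_eq_comb using fin B card
        by (intro dominance_boundD[OF C, of _ "A - B" _ \<alpha>]) (auto simp: w)
    qed
    have "norm (v - P A v) \<le> K * norm w + C * norm w"
      unfolding split using 1 2 norm_triangle_le by (metis add_mono_thms_linordered_semiring(1))
    also have "\<dots> \<le> (K + C + 1) * norm w" by (simp add: distrib_right)
    finally show ?thesis by (simp add: w_def)
  qed
  have "norm (v - greedy_sum smul e e' m v) \<le> (K + C + 1) * best_proj_error smul e e' m v" for v m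
  proof -
    have "norm (v - greedy_sum smul e e' m v) / (K + C + 1) \<le> best_proj_error smul e e' m v"
      unfolding greedy_sum_def using nonneg
      by (intro best_proj_error_ge) (simp add: main[OF greedy_set_thresholding[OF bc]] divide_le_eq mult.commute)
    then show ?thesis using nonneg by (simp add: divide_le_eq mult.commute)
  qed
  moreover have "K + C + 1 > 0" using nonneg by linarith
  ultimately show ?thesis using bc by (auto simp: almost_greedy_def)
qed

text \<open>
  With \<open>w = v - y\<close>, \<open>D\<close> the set of large coordinates of \<open>w\<close> and \<open>q = y + P D w\<close>, the identity \<open>v - q = w - P D w\<close>
  shows that \<open>q\<close> approximates \<open>v\<close> well.  Its support exceeds \<open>A\<close> only by part of \<open>B - A\<close>, where its
  coordinates are at most \<open>2 * \<alpha>\<close>, whereas those of \<open>w\<close> on \<open>A - B\<close> are at least \<open>\<alpha>\<close>.  Hence \<open>q\<close> may be replaced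
  by \<open>z = P A q\<close>.  At level 0 the vector \<open>v\<close> itself is supported in \<open>A\<close>.
\<close>

lemma greedy_span_approximation:
  assumes bc: "bounded_coordinates e'" and K: "thresholding_bound K" and C: "dominance_bound C"
    and A: "weak_thresholding_set e' 1 v m A" and "m \<ge> 1"
    and B: "finite B" "card B \<le> m" "P B y = y"
  shows "\<exists>z. P A z = z \<and> norm (v - z) \<le> (K + 2 * C) * norm (v - y)"
proof -
  have nonneg: "0 \<le> K" "0 \<le> C" using K C by (auto simp: thresholding_bound_def dominance_bound_def)
  have fin: "finite A" "card A = m" using A by (auto simp: weak_thresholding_set_def)
  obtain \<alpha> where "\<alpha> \<ge> 0" and large: "\<And>i. i \<in> A \<Longrightarrow> \<alpha> \<le> norm (e' i v)"
    and small: "\<And>i. i \<notin> A \<Longrightarrow> norm (e' i v) \<le> \<alpha>"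
    using threshold_level[OF A \<open>m \<ge> 1\<close>] by metis
  show ?thesis
  proof (cases "\<alpha> = 0")
    case True
    then have "P A v = v" using small fin by (intro proj_eq_if_zero_outside) auto
    then show ?thesis using nonneg by (intro exI[of _ v]) simp
  next
    case False
    define w where "w = v - y"
    define D where "D = {i. \<alpha> < norm (e' i w)}"
    define q where "q = y + P D w"
    have "D \<subseteq> {i. \<alpha> \<le> norm (e' i w)}" by (auto simp: D_def)
    then have finD: "finite D"
      using finite_large_coordinates[OF bc, of \<alpha> w] False \<open>\<alpha> \<ge> 0\<close> finite_subset by auto
    have y_off: "e' i y = 0" if "i \<notin> B" for i using coord_outside[OF B(3,1) that] .
    (* off B the coordinates of w and v agree, and off A those of v do not exceed the level *)
    have "D \<subseteq> A \<union> B"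
      using small y_off by (force simp: D_def w_def)
    then have "P (A \<union> B) (P D w) = P D w"
      using fin B finD by (simp add: proj_proj Int_absorb1)
    moreover have "P (A \<union> B) y = y" using fin B by (intro proj_fixed_mono[OF B(3)]) auto
    ultimately have "q = P (A \<union> B) q" by (simp add: q_def proj_add)
    also have "\<dots> = P A q + P (B - A) q"
      using proj_union[of A "B - A" q] fin B by simp
    finally have q: "q - P A q = P (B - A) q" by (metis add_diff_cancel_left')
    have "weak_thresholding_set e' 1 w (card D) D"
      using finD by (auto simp: weak_thresholding_set_def D_def)
    from thresholding_boundD[OF K this] have 1: "norm (w - P D w) \<le> K * norm w" .
    have "norm (e' i q) \<le> 2 * \<alpha>" if "i \<in> B - A" for i
    proof (cases "i \<in> D")
      case True
      then have "e' i q = e' i v" using finD by (simp add: q_def coord_proj w_def)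
      then show ?thesis using small[of i] that \<open>\<alpha> \<ge> 0\<close> by simp
    next
      case False
      then have "norm (e' i w) \<le> \<alpha>" by (simp add: D_def)
      moreover have "e' i q = e' i v - e' i w" using False finD by (simp add: q_def coord_proj w_def)
      ultimately show ?thesis using small[of i] that norm_triangle_ineq4[of "e' i v" "e' i w"] by simp
    qed
    (* the factor 2 raises the coordinates of w on A - B to the bound 2 * \<alpha> *)
    then have "norm (P (B - A) q) \<le> C * norm (2 *\<^sub>R w)"
      unfolding proj_eq_comb using fin B large y_off
      by (intro dominance_boundD[OF C, of _ "A - B" _ "2 * \<alpha>"]) (auto simp: w_def intro!: card_le_sym_Diff)
    then have 2: "norm (q - P A q) \<le> 2 * C * norm w" by (simp add: q)
    have "v - P A q = (w - P D w) + (q - P A q)" by (simp add: w_def q_def)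
    then have "norm (v - P A q) \<le> K * norm w + 2 * C * norm w"
      using 1 2 norm_triangle_le by (metis add_mono_thms_linordered_semiring(1))
    then show ?thesis
      using fin by (intro exI[of _ "P A q"]) (simp add: proj_proj w_def distrib_right)
  qed
qed

text \<open>
  The approximant depends on the competitor, so the infimum in the best error is not passed to the
  limit directly: a positive infimum is approached up to the factor 2, and if it is 0, the
  approximants converge to \<open>v\<close>, which therefore lies in the span itself.
\<close>

lemma semi_greedyI:
  assumes bc: "bounded_coordinates e'" and K: "thresholding_bound K" and C: "dominance_bound C"
  shows "semi_greedy smul e e'"
proof -
  have nonneg: "0 \<le> K" "0 \<le> C" using K C by (auto simp: thresholding_bound_def dominance_bound_def)
  define N where "N = K + 2 * C + 1"
  have "N > 0" using nonneg by (simp add: N_def)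
  have "\<exists>z \<in> span (e ` greedy_set e' m v). norm (v - z) \<le> 2 * N * best_error smul e e' m v"
    if "m \<ge> 1" for v m
  proof -
    define A where "A = greedy_set e' m v"
    have A: "weak_thresholding_set e' 1 v m A" unfolding A_def by (rule greedy_set_thresholding[OF bc])
    then have fin: "finite A" by (simp add: weak_thresholding_set_def)
    define \<sigma> where "\<sigma> = best_error smul e e' m v"
    have approx: "\<exists>z. P A z = z \<and> norm (v - z) \<le> N * r" if r: "\<sigma> < r" for r
    proof -
      obtain B y where B: "finite B" "card B \<le> m" "P B y = y" and y: "norm (v - y) < r"
        using best_error_ge[of m r v] r by (force simp: \<sigma>_def)
      obtain z where z: "P A z = z" "norm (v - z) \<le> (K + 2 * C) * norm (v - y)"
        using greedy_span_approximation[OF bc K C A \<open>m \<ge> 1\<close> B] by blast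
      have "(K + 2 * C) * norm (v - y) \<le> N * r"
        using y nonneg by (intro mult_mono) (auto simp: N_def)
      then show ?thesis using z by fastforce
    qed
    have "\<sigma> \<ge> 0" unfolding \<sigma>_def by (rule best_error_ge) simp
    have "\<exists>z. P A z = z \<and> norm (v - z) \<le> 2 * N * \<sigma>"
    proof (cases "\<sigma> = 0")
      case False
      then show ?thesis using approx[of "2 * \<sigma>"] \<open>\<sigma> \<ge> 0\<close> by (simp add: mult.assoc mult.left_commute)
    next
      case True
      have "\<forall>n. \<exists>z. P A z = z \<and> norm (v - z) \<le> N * (1 / real (Suc n))"
        using True by (intro allI approx) simp
      then obtain z where z: "\<And>n. P A (z n) = z n" "\<And>n. norm (v - z n) \<le> N * (1 / real (Suc n))"
        by metis
      have "(\<lambda>n. N * (1 / real (Suc n))) \<longlonglongrightarrow> N * 0"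
        by (intro tendsto_mult tendsto_const) (use LIMSEQ_inverse_real_of_nat in \<open>simp add: inverse_eq_divide\<close>)
      then have "(\<lambda>n. v - z n) \<longlonglongrightarrow> 0"
        using Lim_null_comparison[of "\<lambda>n. v - z n" "\<lambda>n. N * (1 / real (Suc n))" sequentially] z(2) by simp
      then have lim: "z \<longlonglongrightarrow> v"
        using tendsto_diff[OF tendsto_const[of v], of "\<lambda>n. v - z n" 0] by simp
      have "z \<longlonglongrightarrow> P A v" using proj_tendsto[OF lim, of A] by (simp add: z)
      then have "P A v = v" using lim LIMSEQ_unique by blast
      then show ?thesis using \<open>\<sigma> \<ge> 0\<close> \<open>N > 0\<close> by (intro exI[of _ v]) simp
    qed
    then show ?thesis using in_span_iff[OF fin] by (auto simp: A_def \<sigma>_def)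
  qed
  then show ?thesis
    unfolding semi_greedy_def using bc \<open>N > 0\<close> by (intro conjI exI[of _ "2 * N"]) auto
qed

section \<open>Weak almost greedy bases\<close>

text \<open>
  In \<open>v = comb E a + s *\<^sub>R x\<close> the scalar \<open>s\<close> is large enough to force \<open>G\<close> as the thresholding set.  Removing the
  coordinates in \<open>G\<close> leaves \<open>comb E a\<close>, while the competing projection onto \<open>E\<close> leaves \<open>s *\<^sub>R x\<close>.
\<close>

lemma WAG_flat_comparison:
  assumes M: "M > 0"
    "\<And>v m. m \<ge> 1 \<Longrightarrow> \<exists>W. weak_thresholding_set e' \<tau> v m W \<and>
        norm (v - P W v) \<le> M * best_proj_error smul e e' m v"
    and "0 < \<tau>" "\<tau> \<le> 1" "0 < \<alpha>" "0 < \<beta>"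
    and E: "finite E" "card E \<le> card G" "E \<inter> G = {}" "\<And>i. i \<in> E \<Longrightarrow> norm (a i) \<le> \<alpha>"
    and G: "finite G" "P G x = x" "\<And>i. i \<in> G \<Longrightarrow> \<beta> \<le> norm (e' i x)"
  shows "norm (comb E a) \<le> M * (2 * \<alpha> / (\<tau> * \<beta>)) * norm x"
proof (cases "card G = 0")
  case True
  then show ?thesis using E G M assms(3-6) by (simp add: comb_def)
next
  case False
  define s where "s = 2 * \<alpha> / (\<tau> * \<beta>)"
  have "s > 0" using assms by (simp add: s_def)
  define v where "v = comb E a + s *\<^sub>R x"
  have v: "e' i v = (if i \<in> E then a i else 0) + s *\<^sub>R e' i x" for i
    using E by (simp add: v_def coord_comb)
  have x_off: "e' i x = 0" if "i \<notin> G" for i using coord_outside[OF G(2,1) that] .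
  obtain W where W: "weak_thresholding_set e' \<tau> v (card G) W"
    "norm (v - P W v) \<le> M * best_proj_error smul e e' (card G) v"
    using M(2)[of "card G" v] False by auto
  have "W = G"
  proof (rule weak_thresholding_set_unique[OF W(1) G(1) refl, of "2 * \<alpha> / \<tau>"])
    show "2 * \<alpha> / \<tau> \<le> norm (e' j v)" if "j \<in> G" for j
    proof -
      have "2 * \<alpha> / \<tau> = s * \<beta>" using assms by (simp add: s_def)
      also have "\<dots> \<le> s * norm (e' j x)" using G(3)[OF that] \<open>s > 0\<close> by simp
      also have "\<dots> = norm (e' j v)" using that E(3) \<open>s > 0\<close> by (auto simp: v)
      finally show ?thesis .
    qed
    show "norm (e' j v) < \<tau> * (2 * \<alpha> / \<tau>)" if "j \<notin> G" for j
      using that E(4)[of j] assms(3,5) by (auto simp: v x_off)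
  qed (use assms in auto)
  have "P G (comb E a) = 0"
    using E(1,3) by (auto simp: proj_def coord_comb intro!: sum.neutral)
  then have vG: "v - P G v = comb E a"
    by (simp add: v_def proj_add proj_scaleR G)
  have "e' i x = 0" if "i \<in> E" for i using x_off E(3) that by blast
  then have "P E x = 0" by (simp add: proj_def)
  then have vE: "v - P E v = s *\<^sub>R x"
    by (simp add: v_def proj_add proj_scaleR proj_comb E)
  have "norm (comb E a) \<le> M * best_proj_error smul e e' (card G) v"
    using W(2) by (simp add: \<open>W = G\<close> vG)
  also have "\<dots> \<le> M * norm (v - P E v)"
    using M(1) E by (intro mult_left_mono best_proj_error_le) auto
  finally show ?thesis using \<open>s > 0\<close> by (simp add: vE s_def[symmetric] mult.assoc)
qed

text \<open>
  For dominance, a weak thresholding set \<open>W\<close> of \<open>v\<close> with \<open>card F\<close> elements carries coefficients of modulus at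
  least \<open>\<tau> * \<alpha>\<close>, and \<open>norm (P W v) \<le> (1 + M) * norm v\<close> since the empty projection competes.  As \<open>E\<close> may meet \<open>W\<close>,
  the comparison passes through a flat vector on a set \<open>H\<close> disjoint from both.  For the thresholding
  bound, \<open>P F v\<close> and \<open>P W v\<close> differ by their parts on \<open>F - W\<close> and \<open>W - F\<close>, which are dominated by \<open>v\<close>: the
  coordinates there are at most \<open>\<alpha> / \<tau>\<close> and \<open>\<alpha>\<close>, respectively.
\<close>

lemma WAG_bounds:
  assumes WAG: "WAG smul e e' \<tau>" and "0 < \<tau>" "\<tau> \<le> 1"
  shows "\<exists>K C. thresholding_bound K \<and> dominance_bound C"
proof -
  obtain M where M: "M > 0"
    "\<And>v m. m \<ge> 1 \<Longrightarrow> \<exists>W. weak_thresholding_set e' \<tau> v m W \<and>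
        norm (v - P W v) \<le> M * best_proj_error smul e e' m v"
    using WAG unfolding WAG_def by blast
  have W_ex: "\<exists>W. weak_thresholding_set e' \<tau> v m W \<and> norm (P W v) \<le> (1 + M) * norm v"
    if m: "m \<ge> 1" for v m
  proof -
    obtain W where W: "weak_thresholding_set e' \<tau> v m W"
      "norm (v - P W v) \<le> M * best_proj_error smul e e' m v" using M(2)[OF m, of v] by blast
    have "best_proj_error smul e e' m v \<le> norm (v - P {} v)"
      by (intro best_proj_error_le) auto
    then have "M * best_proj_error smul e e' m v \<le> M * norm v"
      using M(1) by (intro mult_left_mono) (auto simp: proj_def)
    then have "norm (P W v) \<le> norm v + M * norm v"
      using W(2) norm_triangle_sub[of "P W v" v] by (simp add: norm_minus_commute)
    then show ?thesis using W(1) by (auto simp: distrib_right)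
  qed
  define C where "C = M * (2 / \<tau>) * (M * (2 / (\<tau> * \<tau>)) * (1 + M))"
  have "C \<ge> 0" using M(1) \<open>0 < \<tau>\<close> by (simp add: C_def)
  have C: "dominance_bound C"
  proof (rule dominance_boundI[OF \<open>C \<ge> 0\<close>])
    fix E F :: "nat set" and a :: "nat \<Rightarrow> 'k" and v :: 'a and \<alpha> :: real
    assume E: "finite E" "\<And>i. i \<in> E \<Longrightarrow> norm (a i) \<le> \<alpha>"
      and F: "finite F" "card F \<ge> 1" "\<And>i. i \<in> F \<Longrightarrow> \<alpha> \<le> norm (e' i v)"
      and EF: "card E \<le> card F" and "\<alpha> > 0"
    obtain W where W: "weak_thresholding_set e' \<tau> v (card F) W" "norm (P W v) \<le> (1 + M) * norm v"
      using W_ex[OF F(2)] by blast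
    have fin: "finite W" "card W = card F" using W(1) by (auto simp: weak_thresholding_set_def)
    have large: "\<tau> * \<alpha> \<le> norm (e' i v)" if "i \<in> W" for i
      by (rule weak_thresholding_set_large[OF W(1) F(1) refl]) (use F(3) that assms \<open>\<alpha> > 0\<close> in auto)
    have "infinite (- (E \<union> W))" using E fin by (simp add: Compl_eq_Diff_UNIV)
    then obtain H where H: "finite H" "card H = card E" "H \<subseteq> - (E \<union> W)"
      using infinite_arbitrarily_large by blast
    let ?h = "comb H (\<lambda>_. of_real \<alpha>)"
    have 1: "norm ?h \<le> M * (2 * \<alpha> / (\<tau> * (\<tau> * \<alpha>))) * norm (P W v)"
      using \<open>\<alpha> > 0\<close> H EF fin large assms
      by (intro WAG_flat_comparison[OF M, where G = W]) (auto simp: proj_proj coord_proj)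
    have 2: "norm (comb E a) \<le> M * (2 * \<alpha> / (\<tau> * \<alpha>)) * norm ?h"
      using \<open>\<alpha> > 0\<close> H E assms
      by (intro WAG_flat_comparison[OF M, where G = H]) (auto simp: proj_comb coord_comb)
    have "norm (comb E a) \<le> M * (2 / \<tau>) * norm ?h" using 2 \<open>\<alpha> > 0\<close> by simp
    also have "\<dots> \<le> M * (2 / \<tau>) * (M * (2 / (\<tau> * \<tau>)) * norm (P W v))"
      using 1 \<open>\<alpha> > 0\<close> M(1) \<open>0 < \<tau>\<close> by (intro mult_left_mono) (auto simp: mult.assoc)
    also have "\<dots> \<le> M * (2 / \<tau>) * (M * (2 / (\<tau> * \<tau>)) * ((1 + M) * norm v))"
      using W(2) M(1) \<open>0 < \<tau>\<close> by (intro mult_left_mono) auto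
    finally show "norm (comb E a) \<le> C * norm v" by (simp only: C_def mult.assoc)
  qed
  define K where "K = 2 + M + C + C / \<tau>"
  have "K \<ge> 1" using M(1) \<open>C \<ge> 0\<close> \<open>0 < \<tau>\<close> by (simp add: K_def)
  have "thresholding_bound K"
  proof (rule thresholding_boundI[OF \<open>K \<ge> 1\<close>])
    fix v F and \<alpha> :: real
    assume F: "finite F" "card F \<ge> 1" and large: "\<And>i. i \<in> F \<Longrightarrow> \<alpha> \<le> norm (e' i v)"
      and small: "\<And>i. i \<notin> F \<Longrightarrow> norm (e' i v) \<le> \<alpha>"
    obtain W where W: "weak_thresholding_set e' \<tau> v (card F) W" "norm (P W v) \<le> (1 + M) * norm v"
      using W_ex[OF F(2)] by blast
    have fin: "finite W" "finite F" "card W = card F"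
      using W(1) F by (auto simp: weak_thresholding_set_def)
    have 1: "norm (P (W - F) v) \<le> C * norm v"
      unfolding proj_eq_comb using fin large small card_mono[of W "W - F"]
      by (intro dominance_boundD[OF C, of _ F _ \<alpha>]) auto
    have "norm (e' i v) \<le> \<alpha> / \<tau>" if "i \<in> F - W" for i
    proof -
      have "\<not> W \<subseteq> F" using card_subset_eq[OF fin(2) _ fin(3)] that by blast
      then obtain j where j: "j \<in> W" "j \<notin> F" by blast
      have "\<tau> * norm (e' i v) \<le> norm (e' j v)"
        using W(1) j that by (auto simp: weak_thresholding_set_def)
      then show ?thesis using small[OF j(2)] \<open>0 < \<tau>\<close> by (simp add: field_simps)
    qed
    then have "norm (P (F - W) v) \<le> C * norm ((1 / \<tau>) *\<^sub>R v)"
      unfolding proj_eq_comb using fin large \<open>0 < \<tau>\<close> card_mono[of F "F - W"]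
      by (intro dominance_boundD[OF C, of _ F _ "\<alpha> / \<tau>"]) (auto simp: divide_right_mono)
    then have 2: "norm (P (F - W) v) \<le> C / \<tau> * norm v" using \<open>0 < \<tau>\<close> by simp
    have "P F v = P W v + (P (F - W) v - P (W - F) v)"
      using proj_split[OF fin(1), of v F] proj_split[OF fin(2), of v W] by (simp add: Int_commute)
    then have split: "v - P F v = v - P W v - P (F - W) v + P (W - F) v" by simp
    have "norm (v - P F v) \<le> norm v + norm (P W v) + norm (P (F - W) v) + norm (P (W - F) v)"
      using norm_triangle_ineq[of "v - P W v - P (F - W) v" "P (W - F) v"]
        norm_triangle_ineq4[of "v - P W v" "P (F - W) v"] norm_triangle_ineq4[of v "P W v"]
      unfolding split by linarith
    also have "\<dots> \<le> norm v + (1 + M) * norm v + C / \<tau> * norm v + C * norm v"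
      using W(2) 1 2 by linarith
    also have "\<dots> = K * norm v" by (simp add: K_def algebra_simps)
    finally show "norm (v - P F v) \<le> K * norm v" .
  qed
  then show ?thesis using C by blast
qed

end

section \<open>Ramsey's theorem and Cesaro means\<close>

lemma Ramsey_finite_range:
  fixes f :: "'a set \<Rightarrow> 'b" and r :: nat
  assumes "infinite Z" "finite (f ` {X. X \<subseteq> Z \<and> finite X \<and> card X = r})"
  obtains Y t where "Y \<subseteq> Z" "infinite Y" "\<And>X. X \<subseteq> Y \<Longrightarrow> finite X \<Longrightarrow> card X = r \<Longrightarrow> f X = t"
proof -
  let ?S = "f ` {X. X \<subseteq> Z \<and> finite X \<and> card X = r}"
  obtain h :: "'b \<Rightarrow> nat" and s where h: "h ` ?S = {i. i < s}" "inj_on h ?S"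
    using finite_imp_inj_to_nat_seg[OF assms(2)] by blast
  have "\<forall>X. X \<subseteq> Z \<and> finite X \<and> card X = r \<longrightarrow> (h \<circ> f) X < s"
    using h(1) by auto
  then obtain Y t where Y: "Y \<subseteq> Z" "infinite Y"
    "\<And>X. X \<subseteq> Y \<Longrightarrow> finite X \<Longrightarrow> card X = r \<Longrightarrow> h (f X) = t"
    using Ramsey[OF assms(1), of r "h \<circ> f" s] by auto
  obtain X0 where X0: "finite X0" "card X0 = r" "X0 \<subseteq> Y"
    using infinite_arbitrarily_large[OF Y(2)] by blast
  have "f X = f X0" if "X \<subseteq> Y" "finite X" "card X = r" for X
  proof (rule inj_onD[OF h(2)])
    show "h (f X) = h (f X0)" using Y(3) that X0 by metis
  qed (use that X0 Y(1) in auto)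
  then show thesis using that Y(1,2) by blast
qed

text \<open>
  The colour of a point is the nearby centre in a finite net; it lets Ramsey's theorem make
  finitely many bounded scalars constant up to \<open>\<eta>\<close>.
\<close>

lemma compact_finite_colouring:
  fixes S :: "'a::metric_space set"
  assumes "compact S" "\<eta> > 0"
  obtains \<kappa> :: "'a \<Rightarrow> 'a" where "finite (\<kappa> ` S)"
    "\<And>a b. a \<in> S \<Longrightarrow> b \<in> S \<Longrightarrow> \<kappa> a = \<kappa> b \<Longrightarrow> dist a b < \<eta>"
proof -
  obtain k where k: "finite k" "S \<subseteq> (\<Union>x\<in>k. ball x (\<eta> / 2))"
    using assms compact_eq_totally_bounded[of S] half_gt_zero by blast
  then have "\<forall>a\<in>S. \<exists>x. x \<in> k \<and> a \<in> ball x (\<eta> / 2)" by blast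
  then obtain \<kappa> where \<kappa>: "\<And>a. a \<in> S \<Longrightarrow> \<kappa> a \<in> k \<and> a \<in> ball (\<kappa> a) (\<eta> / 2)" by metis
  show thesis
  proof (rule that)
    show "finite (\<kappa> ` S)" using \<kappa> k(1) by (meson finite_subset image_subsetI)
    fix a b assume "a \<in> S" "b \<in> S" "\<kappa> a = \<kappa> b"
    then have "dist (\<kappa> a) a < \<eta> / 2" "dist (\<kappa> a) b < \<eta> / 2" using \<kappa> by force+
    then show "dist a b < \<eta>" by (rule dist_triangle_half_r)
  qed
qed

definition average :: "(nat \<Rightarrow> 'a::real_normed_vector) \<Rightarrow> nat \<Rightarrow> 'a" where
  "average f n = (1 / real n) *\<^sub>R (\<Sum>i<n. f i)"

lemma norm_average_le:
  assumes "\<And>i. norm (f i) \<le> r" "0 \<le> r"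
  shows "norm (average f n) \<le> r"
proof (cases "n = 0")
  case False
  have "norm (\<Sum>i<n. f i) \<le> real n * r"
    using sum_norm_le[of "{..<n}" f "\<lambda>_. r"] assms by simp
  then show ?thesis using False by (simp add: average_def field_simps)
qed (simp add: average_def assms)

text \<open>
  Shifting changes only \<open>k\<close> terms at each end of the sum.
\<close>

lemma average_shift:
  assumes B: "\<And>i. norm (f i) \<le> B"
  shows "(\<lambda>n. average (\<lambda>i. f (i + k)) n - average f n) \<longlonglongrightarrow> 0"
proof -
  have "(\<Sum>i<n. f (i + k)) + (\<Sum>i<k. f i) = (\<Sum>i<n + k. f i)" for n
    by (induction n) (auto simp: algebra_simps)
  moreover have "(\<Sum>i<n + k. f i) = (\<Sum>i<n. f i) + (\<Sum>i<k. f (n + i))" for n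
    by (induction k) (auto simp: algebra_simps)
  ultimately have "(\<Sum>i<n. f (i + k)) + (\<Sum>i<k. f i) = (\<Sum>i<n. f i) + (\<Sum>i<k. f (n + i))" for n
    by simp
  then have "(\<Sum>i<n. f (i + k)) - (\<Sum>i<n. f i) = (\<Sum>i<k. f (n + i)) - (\<Sum>i<k. f i)" for n
    by (simp only: diff_eq_eq diff_add_eq eq_diff_eq add.commute[of "\<Sum>i<n. f i"])
  then have eq: "average (\<lambda>i. f (i + k)) n - average f n = (1 / real n) *\<^sub>R ((\<Sum>i<k. f (n + i)) - (\<Sum>i<k. f i))" for n
    by (simp add: average_def flip: scaleR_diff_right)
  have "norm ((\<Sum>i<k. f (n + i)) - (\<Sum>i<k. f i)) \<le> 2 * k * B" for n
  proof -
    have "norm (\<Sum>i<k. f (n + i)) \<le> k * B" "norm (\<Sum>i<k. f i) \<le> k * B"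
      using sum_norm_le[of "{..<k}" f "\<lambda>_. B"] sum_norm_le[of "{..<k}" "\<lambda>i. f (n + i)" "\<lambda>_. B"] B by auto
    then show ?thesis using norm_triangle_ineq4[of "\<Sum>i<k. f (n + i)" "\<Sum>i<k. f i"] by linarith
  qed
  then have le: "norm (average (\<lambda>i. f (i + k)) n - average f n) \<le> (1 / real n) * (2 * k * B)" for n
    unfolding eq norm_scaleR by (simp add: divide_right_mono)
  have "(\<lambda>n. (1 / real n) * (2 * k * B)) \<longlonglongrightarrow> 0"
    by (intro tendsto_mult_left_zero lim_1_over_n)
  then show ?thesis
    by (rule Lim_null_comparison[rotated]) (use le in simp)
qed

section \<open>Separation from far basis vectors\<close>

context M_basis begin

text \<open>
  The hypothesis \<open>close\<close> says that separation from \<open>E\<close> fails with constant \<open>1 / \<epsilon>\<close> for every \<open>m\<close>-element subset of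
  \<open>N\<close>.  Each subset is coloured by the coefficients of its pair \<open>x\<close>, \<open>y\<close>, the latter listed in increasing
  order of the indices.  On a homogeneous set \<open>N'\<close> a single unit vector \<open>x0\<close> and a single list \<open>a\<close> of coefficients
  work for all subsets up to \<open>2 * \<epsilon>\<close>.  In the mean over shifted windows of a sequence in \<open>N'\<close>, each position of
  the window contributes the same Cesaro mean asymptotically, so \<open>x0\<close> is close to \<open>A\<close> times that mean, where
  \<open>A\<close> is the sum of the coefficients; the vector sought is \<open>u = x0 / A\<close>.
\<close>

lemma averages_near_point:
  assumes c: "\<And>i v. norm (e' i v) \<le> c * norm v" "c > 0" and B: "\<And>i. norm (e i) \<le> B"
    and E: "finite E" and N: "infinite N" and \<epsilon>: "0 < \<epsilon>" "\<epsilon> < 1 / 3"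
    and close: "\<And>G. G \<subseteq> N \<Longrightarrow> finite G \<Longrightarrow> card G = m \<Longrightarrow>
      \<exists>x y. P E x = x \<and> P G y = y \<and> norm x = 1 \<and> norm (x - y) \<le> \<epsilon>"
  obtains N' u where "N' \<subseteq> N" "infinite N'" "u \<noteq> 0"
    "\<And>g. strict_mono g \<Longrightarrow> \<forall>\<^sub>F n in sequentially. g n \<in> N' \<Longrightarrow>
       \<forall>\<^sub>F n in sequentially. norm (u - average (\<lambda>i. e (g i)) n) \<le> 3 * \<epsilon> * norm u"
proof -
  have "B \<ge> 0" using B[of 0] norm_ge_zero order_trans by blast
  have "\<forall>G. \<exists>x y. G \<subseteq> N \<and> finite G \<and> card G = m \<longrightarrow>
      P E x = x \<and> P G y = y \<and> norm x = 1 \<and> norm (x - y) \<le> \<epsilon>"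
    using close by blast
  then obtain x y where xy: "\<And>G. G \<subseteq> N \<Longrightarrow> finite G \<Longrightarrow> card G = m \<Longrightarrow>
      P E (x G) = x G \<and> P G (y G) = y G \<and> norm (x G) = 1 \<and> norm (x G - y G) \<le> \<epsilon>"
    by metis
  (* with this mesh, changing all coefficients within their colours costs at most \<epsilon> in norm *)
  define L where "L = (\<Sum>j\<in>E. norm (e j)) + m * B + 1"
  have "L > 0" using \<open>B \<ge> 0\<close> sum_nonneg[of E "\<lambda>j. norm (e j)"] by (simp add: L_def add_nonneg_pos)
  define \<eta> where "\<eta> = \<epsilon> / L"
  have "\<eta> > 0" using \<open>L > 0\<close> \<epsilon> by (simp add: \<eta>_def)
  obtain \<kappa> :: "'k \<Rightarrow> 'k" where \<kappa>: "finite (\<kappa> ` cball 0 (2 * c))"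
    "\<And>a b. a \<in> cball 0 (2 * c) \<Longrightarrow> b \<in> cball 0 (2 * c) \<Longrightarrow> \<kappa> a = \<kappa> b \<Longrightarrow> dist a b < \<eta>"
    using compact_finite_colouring[OF compact_cball \<open>\<eta> > 0\<close>] by blast
  define b where "b G i = e' (sorted_list_of_set G ! i) (y G)" for G i
  have coeffs: "e' j (x G) \<in> cball 0 (2 * c)" "b G i \<in> cball 0 (2 * c)"
    if "G \<subseteq> N" "finite G" "card G = m" for G i j
  proof -
    have G: "norm (x G) = 1" "norm (x G - y G) \<le> \<epsilon>" using xy[OF that] by auto
    have "norm (y G) \<le> 2" using G \<epsilon> norm_triangle_ineq2[of "y G" "x G"] by (simp add: norm_minus_commute)
    then have "c * norm (y G) \<le> c * 2" "c * norm (x G) \<le> c * 2"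
      using c(2) G(1) by (intro mult_left_mono; simp)+
    then show "e' j (x G) \<in> cball 0 (2 * c)" "b G i \<in> cball 0 (2 * c)"
      using c(1)[of j "x G"] c(1)[of "sorted_list_of_set G ! i" "y G"] by (auto simp: b_def)
  qed
  define colour where "colour G = (restrict (\<lambda>j. \<kappa> (e' j (x G))) E, restrict (\<lambda>i. \<kappa> (b G i)) {..<m})" for G
  have "colour ` {G. G \<subseteq> N \<and> finite G \<and> card G = m} \<subseteq>
      (E \<rightarrow>\<^sub>E \<kappa> ` cball 0 (2 * c)) \<times> ({..<m} \<rightarrow>\<^sub>E \<kappa> ` cball 0 (2 * c))"
  proof (rule image_subsetI)
    fix G assume "G \<in> {G. G \<subseteq> N \<and> finite G \<and> card G = m}"
    then have "G \<subseteq> N" "finite G" "card G = m" by auto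
    then show "colour G \<in> (E \<rightarrow>\<^sub>E \<kappa> ` cball 0 (2 * c)) \<times> ({..<m} \<rightarrow>\<^sub>E \<kappa> ` cball 0 (2 * c))"
      unfolding colour_def mem_Times_iff fst_conv snd_conv restrict_PiE_iff
      using coeffs by blast
  qed
  moreover have "finite \<dots>" using E \<kappa>(1) by (intro finite_cartesian_product finite_PiE) auto
  ultimately have fin: "finite (colour ` {G. G \<subseteq> N \<and> finite G \<and> card G = m})"
    by (rule finite_subset)
  obtain N' t where N': "N' \<subseteq> N" "infinite N'"
    and t: "\<And>G. G \<subseteq> N' \<Longrightarrow> finite G \<Longrightarrow> card G = m \<Longrightarrow> colour G = t"
    by (rule Ramsey_finite_range[OF N fin]) (rule that)
  obtain G0 where G0: "finite G0" "card G0 = m" "G0 \<subseteq> N'"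
    using infinite_arbitrarily_large[OF N'(2)] by blast
  define x0 where "x0 = x G0"
  define a where "a = b G0"
  have G0N: "G0 \<subseteq> N" using G0(3) N'(1) by blast
  have x0: "norm x0 = 1" "P E x0 = x0" using xy[OF G0N G0(1,2)] by (auto simp: x0_def)
  have window: "norm (x0 - (\<Sum>i<m. smul (a i) (e (h i)))) \<le> 2 * \<epsilon>"
    if h: "strict_mono h" "\<And>i. h i \<in> N'" for h :: "nat \<Rightarrow> nat"
  proof -
    define G where "G = h ` {..<m}"
    have inj: "inj h" by (rule strict_mono_imp_inj_on[OF h(1)])
    then have inj_m: "inj_on h {..<m}" by (rule inj_on_subset) simp
    have G: "finite G" "card G = m" "G \<subseteq> N'" "G \<subseteq> N"
      using inj h(2) N'(1) by (auto simp: G_def card_image inj_on_subset)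
    have "sorted_list_of_set (set (map h [0..<m])) = map h [0..<m]"
      using h(1) inj_on_subset[OF inj subset_UNIV] by (intro sorted_list_of_set.idem_if_sorted_distinct)
        (auto simp: distinct_map sorted_wrt_iff_nth_less strict_mono_less_eq)
    then have bG: "b G i = e' (h i) (y G)" if "i < m" for i
      using that by (simp add: b_def G_def atLeast0LessThan)
    have xyG: "P E (x G) = x G" "P G (y G) = y G" "norm (x G - y G) \<le> \<epsilon>"
      using xy[OF G(4,1,2)] by auto
    have "colour G = colour G0" using t G G0 by metis
    then have "restrict (\<lambda>j. \<kappa> (e' j (x G))) E = restrict (\<lambda>j. \<kappa> (e' j x0)) E"
      "restrict (\<lambda>i. \<kappa> (b G i)) {..<m} = restrict (\<lambda>i. \<kappa> (a i)) {..<m}"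
      by (auto simp: colour_def x0_def a_def)
    then have \<kappa>eq: "j \<in> E \<Longrightarrow> \<kappa> (e' j (x G)) = \<kappa> (e' j x0)" "i < m \<Longrightarrow> \<kappa> (b G i) = \<kappa> (a i)" for i j
      by (metis restrict_apply', metis restrict_apply' lessThan_iff)
    have dx: "norm (e' j x0 - e' j (x G)) \<le> \<eta>" if "j \<in> E" for j
      using \<kappa>(2)[OF coeffs(1)[OF G0N G0(1,2)] coeffs(1)[OF G(4,1,2)]] \<kappa>eq(1)[OF that]
      by (simp add: x0_def dist_norm less_imp_le)
    have db: "norm (b G i - a i) \<le> \<eta>" if "i < m" for i
      using \<kappa>(2)[OF coeffs(2)[OF G(4,1,2)] coeffs(2)[OF G0N G0(1,2)]] \<kappa>eq(2)[OF that]
      by (simp add: a_def dist_norm less_imp_le)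
    have "x0 - x G = comb E (\<lambda>j. e' j x0 - e' j (x G))"
      using x0(2) xyG(1) by (metis comb_diff proj_eq_comb)
    then have 1: "norm (x0 - x G) \<le> \<eta> * (\<Sum>j\<in>E. norm (e j))"
      using dx by (simp add: norm_comb_le)
    have "y G = P G (y G)" using xyG(2) by simp
    also have "\<dots> = (\<Sum>i<m. smul (b G i) (e (h i)))"
      unfolding proj_def G_def
      by (subst sum.reindex[OF inj_m]) (simp add: bG[unfolded G_def])
    finally have "y G - (\<Sum>i<m. smul (a i) (e (h i))) = (\<Sum>i<m. smul (b G i - a i) (e (h i)))"
      by (simp add: scale_left_diff_distrib sum_subtractf)
    moreover have "norm \<dots> \<le> (\<Sum>i<m. \<eta> * B)"
      using db B \<open>\<eta> > 0\<close> by (intro sum_norm_le) (auto simp: norm_smul intro!: mult_mono)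
    ultimately have 2: "norm (y G - (\<Sum>i<m. smul (a i) (e (h i)))) \<le> \<eta> * (m * B)"
      by (simp add: mult.left_commute)
    have "\<eta> * (\<Sum>j\<in>E. norm (e j)) + \<eta> * (m * B) = \<eta> * L - \<eta>" by (simp add: L_def distrib_left)
    also have "\<dots> \<le> \<epsilon>" using \<open>L > 0\<close> \<open>\<eta> > 0\<close> by (simp add: \<eta>_def)
    finally have 3: "\<eta> * (\<Sum>j\<in>E. norm (e j)) + \<eta> * (m * B) \<le> \<epsilon>" .
    have "x0 - (\<Sum>i<m. smul (a i) (e (h i))) = (x0 - x G) + (x G - y G) + (y G - (\<Sum>i<m. smul (a i) (e (h i))))"
      by simp
    also have "norm \<dots> \<le> norm (x0 - x G) + norm (x G - y G) + norm (y G - (\<Sum>i<m. smul (a i) (e (h i))))"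
      by (intro norm_triangle_le add_right_mono norm_triangle_ineq)
    finally show ?thesis using 1 2 3 xyG(3) by linarith
  qed
  define A where "A = (\<Sum>i<m. a i)"
  have near: "\<forall>\<^sub>F n in sequentially. norm (x0 - smul A (average (\<lambda>i. e (g i)) n)) \<le> 3 * \<epsilon>"
    if g: "strict_mono g" "\<forall>\<^sub>F n in sequentially. g n \<in> N'" for g
  proof -
    obtain p where p: "\<And>n. n \<ge> p \<Longrightarrow> g n \<in> N'" using g(2) by (auto simp: eventually_sequentially)
    define f where "f = (\<lambda>i. e (g i))"
    (* the mean of the m-term combination over n windows, all of which start at p or later *)
    define F where "F n = (\<Sum>i<m. smul (a i) (average (\<lambda>q. f (q + (i + p))) n))" for n
    have F_near: "norm (x0 - F n) \<le> 2 * \<epsilon>" if "n \<ge> 1" for n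
    proof -
      have "average (\<lambda>q. x0 - (\<Sum>i<m. smul (a i) (f (q + (i + p))))) n = x0 - F n"
        unfolding average_def F_def using that
        by (simp add: sum_subtractf scaleR_diff_right smul_scaleR scale_sum_right sum_constant_scaleR
            sum.swap[of _ "{..<n}" "{..<m}"] flip: scaleR_right.sum)
      moreover have "norm (x0 - (\<Sum>i<m. smul (a i) (f (q + (i + p))))) \<le> 2 * \<epsilon>" for q
        unfolding f_def
        by (rule window[of "\<lambda>i. g (q + (i + p))"]) (use p g(1) in \<open>auto simp: strict_mono_def\<close>)
      ultimately show ?thesis
        using norm_average_le[of "\<lambda>q. x0 - (\<Sum>i<m. smul (a i) (f (q + (i + p))))" "2 * \<epsilon>" n] \<epsilon> by simp
    qed
    have "(\<lambda>n. \<Sum>i<m. smul (a i) (average (\<lambda>q. f (q + (i + p))) n - average f n)) \<longlonglongrightarrow> (\<Sum>i<m. 0)"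
      by (intro tendsto_sum smul_tendsto_zero average_shift[of _ B]) (simp add: f_def B)
    moreover have "(\<Sum>i<m. smul (a i) (average (\<lambda>q. f (q + (i + p))) n - average f n)) = F n - smul A (average f n)" for n
      by (simp add: F_def A_def scale_right_diff_distrib sum_subtractf scale_sum_left)
    ultimately have "(\<lambda>n. F n - smul A (average f n)) \<longlonglongrightarrow> 0" by simp
    then have "\<forall>\<^sub>F n in sequentially. norm (F n - smul A (average f n)) < \<epsilon>"
      using \<epsilon>(1) by (simp add: tendsto_iff)
    then have "\<forall>\<^sub>F n in sequentially. norm (x0 - smul A (average f n)) \<le> 3 * \<epsilon>"
      using eventually_ge_at_top[of 1]
    proof eventually_elim
      case (elim n)
      have "norm (x0 - smul A (average f n)) \<le> norm (x0 - F n) + norm (F n - smul A (average f n))"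
        by (rule norm_diff_triangle_ineq[of x0 "F n" "F n" "smul A (average f n)", simplified])
      then show ?case using F_near[of n] elim by simp
    qed
    then show ?thesis by (simp add: f_def)
  qed
  (* otherwise the unit vector x0 would itself have norm at most 3 * \<epsilon> < 1 *)
  have "A \<noteq> 0"
  proof
    assume "A = 0"
    have "\<forall>\<^sub>F n in sequentially. norm x0 \<le> 3 * \<epsilon>"
      using near[OF strict_mono_enumerate[OF N'(2)]] enumerate_in_set[OF N'(2)] \<open>A = 0\<close> by simp
    then show False using x0 \<epsilon> by simp
  qed
  define u where "u = smul (inverse A) x0"
  have u: "norm u = norm (inverse A)" using x0 by (simp add: u_def norm_smul)
  show thesis
  proof (rule that[OF N'])
    show "u \<noteq> 0" using u \<open>A \<noteq> 0\<close> by auto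
    fix g assume g: "strict_mono g" "\<forall>\<^sub>F n in sequentially. g n \<in> N'"
    show "\<forall>\<^sub>F n in sequentially. norm (u - average (\<lambda>i. e (g i)) n) \<le> 3 * \<epsilon> * norm u"
      using near[OF g]
    proof eventually_elim
      case (elim n)
      let ?w = "average (\<lambda>i. e (g i)) n"
      have "u - ?w = smul (inverse A) (x0 - smul A ?w)"
        using \<open>A \<noteq> 0\<close> by (simp add: u_def scale_right_diff_distrib)
      then show ?case
        using elim mult_left_mono[OF elim, of "norm u"] by (simp add: norm_smul u mult.commute)
    qed
  qed
qed

definition separated :: "real \<Rightarrow> nat set \<Rightarrow> nat set \<Rightarrow> bool" where
  "separated C E G \<longleftrightarrow> (\<forall>x y. P E x = x \<and> P G y = y \<longrightarrow> norm x \<le> C * norm (x + y))"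

lemma separated_subset:
  "separated C E' G \<Longrightarrow> E \<subseteq> E' \<Longrightarrow> finite E' \<Longrightarrow> separated C E G"
  unfolding separated_def using proj_fixed_mono by blast

text \<open>
  Suppose separation fails for every constant inside every infinite set.  With constants tending to
  infinity this produces nested infinite sets \<open>Ns k\<close> and nonzero vectors \<open>u k\<close> to which the Cesaro means
  along any sequence in \<open>Ns k\<close> are close.  The means along a diagonal sequence are close to all \<open>u k\<close> and so
  form a Cauchy sequence.  Each coordinate of its limit vanishes, because a single index is hit at most
  once; by totality the limit is 0, which contradicts closeness to \<open>u 0 \<noteq> 0\<close>.
\<close>

theorem far_sets_separated:
  assumes bc: "bounded_coordinates e'" and B: "\<And>i. norm (e i) \<le> B"
  obtains C N0 where "C > 0" "infinite N0"
    "\<And>E N m. finite E \<Longrightarrow> N \<subseteq> N0 \<Longrightarrow> infinite N \<Longrightarrow>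
       \<exists>G\<subseteq>N. finite G \<and> card G = m \<and> separated C E G"
proof -
  obtain c where c: "\<And>i v. norm (e' i v) \<le> c * norm v" "c > 0"
    using bc bounded_coordinates_iff by blast
  have "B \<ge> 0" using B[of 0] norm_ge_zero order_trans by blast
  have False
    if neg: "\<And>C N0. C > 0 \<Longrightarrow> infinite N0 \<Longrightarrow> \<exists>E N m. finite E \<and> N \<subseteq> N0 \<and> infinite N \<and>
       (\<forall>G\<subseteq>N. finite G \<and> card G = m \<longrightarrow> \<not> separated C E G)"
  proof -
    (* the offset 4 makes 3 * \<epsilon> k < 1, so that closeness to u relative to its norm excludes 0 *)
    define \<epsilon> where "\<epsilon> k = 1 / (real k + 4)" for k :: nat
    have \<epsilon>: "0 < \<epsilon> k" "\<epsilon> k < 1 / 3" "3 * \<epsilon> k \<le> 3 / 4" for k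
      by (auto simp: \<epsilon>_def field_simps)
    define near where "near k N u \<longleftrightarrow> u \<noteq> 0 \<and> (\<forall>g. strict_mono g \<and> (\<forall>\<^sub>F n in sequentially. g n \<in> N) \<longrightarrow>
        (\<forall>\<^sub>F n in sequentially. norm (u - average (\<lambda>i. e (g i)) n) \<le> 3 * \<epsilon> k * norm u))"
      for k :: nat and N u
    have step: "\<exists>N'\<subseteq>N0. infinite N' \<and> (\<exists>u. near k N' u)" if N0: "infinite N0" for N0 k
    proof -
      have "1 / \<epsilon> k > 0" using \<epsilon>[of k] by simp
      then obtain E N m where E: "finite E" and N: "N \<subseteq> N0" "infinite N"
        and nsep: "\<And>G. G \<subseteq> N \<Longrightarrow> finite G \<Longrightarrow> card G = m \<Longrightarrow> \<not> separated (1 / \<epsilon> k) E G"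
        using neg[OF _ N0] by metis
      have close: "\<exists>x y. P E x = x \<and> P G y = y \<and> norm x = 1 \<and> norm (x - y) \<le> \<epsilon> k"
        if G: "G \<subseteq> N" "finite G" "card G = m" for G
      proof -
        obtain x y where xy: "P E x = x" "P G y = y" "norm x > 1 / \<epsilon> k * norm (x + y)"
          using nsep[OF G] by (auto simp: separated_def not_le)
        define r where "r = norm x"
        have "r > 0" using xy(3) \<epsilon>(1)[of k] unfolding r_def
          by (meson divide_nonneg_pos mult_nonneg_nonneg norm_ge_zero order_le_less_trans zero_le_one)
        have "(1 / r) *\<^sub>R x - (- (1 / r)) *\<^sub>R y = (1 / r) *\<^sub>R (x + y)"
          by (simp add: scaleR_add_right)
        then have "norm ((1 / r) *\<^sub>R x - (- (1 / r)) *\<^sub>R y) = norm (x + y) / r"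
          using \<open>r > 0\<close> by simp
        also have "\<dots> \<le> \<epsilon> k" using xy(3) \<open>r > 0\<close> \<epsilon>(1)[of k] by (simp add: r_def field_simps)
        finally have "norm ((1 / r) *\<^sub>R x - (- (1 / r)) *\<^sub>R y) \<le> \<epsilon> k" .
        moreover have "norm ((1 / r) *\<^sub>R x) = 1" using \<open>r > 0\<close> by (simp add: r_def)
        ultimately show ?thesis using xy by (metis proj_scaleR)
      qed
      obtain N' u where "N' \<subseteq> N" "infinite N'" "u \<noteq> 0"
        "\<And>g. strict_mono g \<Longrightarrow> \<forall>\<^sub>F n in sequentially. g n \<in> N' \<Longrightarrow>
          \<forall>\<^sub>F n in sequentially. norm (u - average (\<lambda>i. e (g i)) n) \<le> 3 * \<epsilon> k * norm u"
        using averages_near_point[OF c B E N(2) \<epsilon>(1,2) close] by blast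
      then have "N' \<subseteq> N0" "infinite N'" "near k N' u" using N(1) by (auto simp: near_def)
      then show ?thesis by blast
    qed
    have "\<exists>Ns. \<forall>k. (infinite (Ns k) \<and> (\<exists>u. near k (Ns k) u)) \<and> Ns (Suc k) \<subseteq> Ns k"
      by (rule dependent_nat_choice) (use step[OF infinite_UNIV_nat, of 0] step in blast)+
    then obtain Ns where Ns: "\<And>k. infinite (Ns k)" "\<And>k. \<exists>u. near k (Ns k) u"
      "\<And>k. Ns (Suc k) \<subseteq> Ns k" by blast
    have anti: "Ns j \<subseteq> Ns i" if "i \<le> j" for i j
      using lift_Suc_antimono_le[of Ns, OF Ns(3) that] .
    have "\<exists>g. \<forall>k. g k \<in> Ns k \<and> g k < g (Suc k)"
    proof (rule dependent_nat_choice)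
      show "\<exists>x. x \<in> Ns 0" using Ns(1)[of 0] by (metis finite.emptyI equals0I)
      show "\<exists>y. y \<in> Ns (Suc k) \<and> x < y" if "x \<in> Ns k" for x k
        using Ns(1)[of "Suc k"] by (metis infinite_nat_iff_unbounded)
    qed
    then obtain g where g: "\<And>k. g k \<in> Ns k" "strict_mono g"
      by (auto simp: strict_mono_Suc_iff)
    define s where "s = average (\<lambda>i. e (g i))"
    have "\<forall>\<^sub>F n in sequentially. g n \<in> Ns k" for k
      unfolding eventually_sequentially using anti g(1) by blast
    then have "\<exists>u. u \<noteq> 0 \<and> (\<forall>\<^sub>F n in sequentially. norm (u - s n) \<le> 3 * \<epsilon> k * norm u)" for k
      using Ns(2)[of k] g(2) by (auto simp: near_def s_def)
    then obtain u where u: "\<And>k. u k \<noteq> 0"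
      "\<And>k. \<forall>\<^sub>F n in sequentially. norm (u k - s n) \<le> 3 * \<epsilon> k * norm (u k)" by metis
    have s_le: "norm (s n) \<le> B" for n
      unfolding s_def by (rule norm_average_le) (use B \<open>B \<ge> 0\<close> in auto)
    have u_le: "norm (u k) \<le> 4 * B" for k
    proof -
      obtain n where "norm (u k - s n) \<le> 3 * \<epsilon> k * norm (u k)"
        using u(2)[of k] by (auto simp: eventually_sequentially)
      moreover have "3 * \<epsilon> k * norm (u k) \<le> 3 / 4 * norm (u k)"
        by (intro mult_right_mono \<epsilon>) simp
      ultimately show ?thesis
        using norm_triangle_sub[of "u k" "s n"] s_le[of n] by linarith
    qed
    have "Cauchy s"
      unfolding Cauchy_altdef2
    proof (intro allI impI)
      fix r :: real assume "r > 0"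
      obtain k where "24 * B / r < real k" using reals_Archimedean2 by blast
      then have k: "3 * \<epsilon> k * (4 * B) < r / 2"
        using \<open>r > 0\<close> by (simp add: \<epsilon>_def field_simps)
      obtain n0 where n0: "\<And>n. n \<ge> n0 \<Longrightarrow> norm (u k - s n) \<le> 3 * \<epsilon> k * norm (u k)"
        using u(2)[of k] by (auto simp: eventually_sequentially)
      have "3 * \<epsilon> k * norm (u k) \<le> 3 * \<epsilon> k * (4 * B)"
        using u_le[of k] \<epsilon>(1)[of k] by (intro mult_left_mono) auto
      then have "3 * \<epsilon> k * norm (u k) < r / 2" using k by linarith
      then have near_u: "dist (u k) (s n) < r / 2" if "n \<ge> n0" for n
        using n0[OF that] by (simp add: dist_norm)
      have "dist (s n) (s n0) < r" if "n \<ge> n0" for n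
        by (rule dist_triangle_half_r[OF near_u[OF that] near_u[OF order_refl]])
      then show "\<exists>N. \<forall>n\<ge>N. dist (s n) (s N) < r" by blast
    qed
    then obtain a where a: "s \<longlonglongrightarrow> a" using Cauchy_convergent_iff convergent_def by blast
    have "e' i a = 0" for i
    proof -
      have "norm (e' i (s n)) \<le> 1 / real n" for n
      proof -
        have "(\<Sum>p<n. e' i (e (g p))) = (\<Sum>p\<in>{p. p < n \<and> g p = i}. 1)"
          by (rule sum.mono_neutral_cong_right) auto
        moreover have "card {p. p < n \<and> g p = i} \<le> 1"
          using strict_mono_eq[OF g(2)] by (auto simp: card_le_Suc0_iff_eq)
        ultimately have "norm (\<Sum>p<n. e' i (e (g p))) \<le> 1" by simp
        then show ?thesis by (simp add: s_def average_def coord_sum divide_right_mono)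
      qed
      then have "(\<lambda>n. e' i (s n)) \<longlonglongrightarrow> 0"
        by (intro Lim_null_comparison[OF always_eventually lim_1_over_n] allI)
      then show ?thesis using coord_tendsto[OF a, of i] LIMSEQ_unique by blast
    qed
    then have "a = 0" by (rule total)
    have "(\<lambda>n. norm (u 0 - s n)) \<longlonglongrightarrow> norm (u 0 - a)"
      by (intro tendsto_intros a)
    then have "norm (u 0 - a) \<le> 3 * \<epsilon> 0 * norm (u 0)"
      using u(2)[of 0] by (rule tendsto_upperbound) simp
    then show False using u(1)[of 0] \<open>a = 0\<close> by (simp add: \<epsilon>_def)
  qed
  then obtain C N0 where C: "C > 0" "infinite N0" and sep: "\<not> (\<exists>E N m. finite E \<and> N \<subseteq> N0 \<and> infinite N \<and>
       (\<forall>G\<subseteq>N. finite G \<and> card G = m \<longrightarrow> \<not> separated C E G))" by blast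
  show thesis
  proof (rule that[OF C])
    fix E N :: "nat set" and m assume EN: "finite E" "N \<subseteq> N0" "infinite N"
    show "\<exists>G\<subseteq>N. finite G \<and> card G = m \<and> separated C E G"
    proof (rule ccontr)
      assume "\<not> ?thesis"
      then have "\<forall>G\<subseteq>N. finite G \<and> card G = m \<longrightarrow> \<not> separated C E G" by auto
      then show False using sep EN by metis
    qed
  qed
qed

section \<open>Weak semi-greedy bases\<close>

text \<open>
  The case \<open>m = 1\<close> with \<open>v = e j + t *\<^sub>R e 0\<close>: for large \<open>t\<close> the thresholding set is \<open>{0}\<close>, so some vector
  \<open>e j + smul a (e 0)\<close> is no larger than a multiple of \<open>e 0\<close>, and its coordinate \<open>a\<close> is controlled by its norm.
\<close>

lemma WSG_basis_bounded:
  assumes bc: "bounded_coordinates e'" and "0 < \<tau>" "\<tau> \<le> 1" and M: "M > 0"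
    "\<And>v m. m \<ge> 1 \<Longrightarrow> \<exists>W z. weak_thresholding_set e' \<tau> v m W \<and> P W z = z \<and>
        norm (v - z) \<le> M * best_error smul e e' m v"
  obtains B where "\<And>i. norm (e i) \<le> B"
proof -
  obtain c where c: "\<And>i v. norm (e' i v) \<le> c * norm v" "c > 0"
    using bc bounded_coordinates_iff by blast
  define t where "t = 2 / \<tau>"
  have "t > 0" using \<open>0 < \<tau>\<close> by (simp add: t_def)
  define B where "B = norm (e 0) + (1 + c * norm (e 0)) * (M * (t * norm (e 0)))"
  have "norm (e j) \<le> B" for j
  proof (cases "j = 0")
    case True
    then show ?thesis using M(1) \<open>t > 0\<close> c(2) by (simp add: B_def)
  next
    case False
    define v where "v = e j + t *\<^sub>R e 0"
    have v: "e' i v = (if i = j then 1 else 0) + (if i = 0 then of_real t else 0)" for i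
      by (simp add: v_def scaleR_conv_of_real)
    obtain W z where W: "weak_thresholding_set e' \<tau> v 1 W" and z: "P W z = z"
      "norm (v - z) \<le> M * best_error smul e e' 1 v" using M(2)[of 1 v] by auto
    have "W = {0}"
      by (rule weak_thresholding_set_unique[OF W, of _ "2 / \<tau>"])
        (use False \<open>t > 0\<close> assms(2,3) in \<open>auto simp: v t_def[symmetric]\<close>, auto simp: t_def)
    have "best_error smul e e' 1 v \<le> norm (v - e j)"
      by (rule best_error_le[of "{j}"]) (auto simp: proj_def)
    also have "norm (v - e j) = t * norm (e 0)" using \<open>t > 0\<close> by (simp add: v_def)
    finally have "M * best_error smul e e' 1 v \<le> M * (t * norm (e 0))"
      using M(1) by (intro mult_left_mono) auto
    then have vz: "norm (v - z) \<le> M * (t * norm (e 0))" using z(2) by linarith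
    have "z = smul (e' 0 z) (e 0)" using z(1) unfolding \<open>W = {0}\<close> by (simp add: proj_def)
    moreover have "t *\<^sub>R e 0 = smul (of_real t) (e 0)" by (simp add: smul_of_real)
    ultimately have "v - z = e j + smul (e' 0 (v - z)) (e 0)"
      using False by (simp add: v scale_left_diff_distrib) (simp add: v_def)
    then have "norm (e j) \<le> norm (v - z) + norm (smul (e' 0 (v - z)) (e 0))"
      by (metis add_diff_cancel_right' norm_triangle_ineq4)
    also have "\<dots> \<le> norm (v - z) + (c * norm (v - z)) * norm (e 0)"
      using c(1)[of 0 "v - z"] by (simp add: norm_smul mult_right_mono del: coord_diff)
    also have "\<dots> = (1 + c * norm (e 0)) * norm (v - z)" by (simp add: algebra_simps)
    also have "\<dots> \<le> (1 + c * norm (e 0)) * (M * (t * norm (e 0)))"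
      using vz c(2) by (intro mult_left_mono) auto
    finally show ?thesis by (simp add: B_def add_increasing)
  qed
  then show thesis using that by blast
qed

text \<open>
  The flat vector enters with coefficients so small that the thresholding set \<open>W\<close> avoids \<open>G\<close>.  As the flat
  vector itself is a competitor, \<open>norm (w - z + s *\<^sub>R h) \<le> M * norm w\<close> with \<open>z\<close> supported in \<open>S\<close>, and separation bounds
  \<open>w - z\<close>, hence \<open>s *\<^sub>R h\<close>.
\<close>

lemma WSG_bounds_flat_vector:
  assumes "0 < \<tau>" "\<tau> \<le> 1" and M: "M > 0"
    "\<And>v m. m \<ge> 1 \<Longrightarrow> \<exists>W z. weak_thresholding_set e' \<tau> v m W \<and> P W z = z \<and>
        norm (v - z) \<le> M * best_error smul e e' m v"
    and S: "finite S" "P S w = w"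
    and F: "finite F" "card F \<ge> 1" "\<And>i. i \<in> F \<Longrightarrow> \<alpha> \<le> norm (e' i w)" and "\<alpha> > 0"
    and G: "finite G" "card G = card F" "S \<inter> G = {}" "separated C S G" and "C \<ge> 0"
  shows "\<alpha> * norm (comb G (\<lambda>_. 1)) \<le> 2 / \<tau> * (1 + C) * M * norm w"
proof -
  define h where "h = comb G (\<lambda>_. 1)"
  have h: "P G h = h" "\<And>i. e' i h = (if i \<in> G then 1 else 0)"
    using G by (auto simp: h_def proj_comb coord_comb)
  define s where "s = \<tau> * \<alpha> / 2"
  have "s > 0" using assms by (simp add: s_def)
  define v where "v = w + s *\<^sub>R h"
  have w_off: "e' i w = 0" if "i \<notin> S" for i using coord_outside[OF S(2,1) that] .
  have v: "e' i v = (if i \<in> S then e' i w else if i \<in> G then of_real s else 0)" for i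
    using G(3) by (auto simp: v_def h w_off scaleR_conv_of_real)
  have "F \<subseteq> S" using F(3) w_off \<open>\<alpha> > 0\<close> by fastforce
  obtain W z where W: "weak_thresholding_set e' \<tau> v (card F) W" and z: "P W z = z"
    "norm (v - z) \<le> M * best_error smul e e' (card F) v" using M(2)[OF F(2), of v] by auto
  have "W \<subseteq> S"
  proof
    fix i assume "i \<in> W"
    have "\<tau> * \<alpha> \<le> norm (e' i v)"
      by (rule weak_thresholding_set_large[OF W F(1) refl _ _ _ _ \<open>i \<in> W\<close>])
        (use F(3) \<open>F \<subseteq> S\<close> assms(1,2) \<open>\<alpha> > 0\<close> in \<open>auto simp: v\<close>)
    moreover have "norm (e' i v) \<le> s" if "i \<notin> S" using that \<open>s > 0\<close> by (simp add: v)
    moreover have "s < \<tau> * \<alpha>" using assms by (simp add: s_def)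
    ultimately show "i \<in> S" by force
  qed
  then have "P S (w - z) = w - z"
    using S z(1) by (simp add: proj_diff proj_fixed_mono)
  moreover have "P G (s *\<^sub>R h) = s *\<^sub>R h" by (simp add: proj_scaleR h)
  ultimately have 1: "norm (w - z) \<le> C * norm (w - z + s *\<^sub>R h)"
    using G(4) by (simp add: separated_def)
  have "best_error smul e e' (card F) v \<le> norm (v - s *\<^sub>R h)"
    using G by (intro best_error_le[of G]) (auto simp: proj_scaleR h)
  then have "M * best_error smul e e' (card F) v \<le> M * norm w"
    using M(1) by (intro mult_left_mono) (auto simp: v_def)
  then have 2: "norm (w - z + s *\<^sub>R h) \<le> M * norm w"
    using z(2) by (simp add: v_def algebra_simps)
  have "s * norm h = norm ((w - z + s *\<^sub>R h) - (w - z))" using \<open>s > 0\<close> by simp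
  also have "\<dots> \<le> norm (w - z + s *\<^sub>R h) + norm (w - z)" by (rule norm_triangle_ineq4)
  also have "\<dots> \<le> (1 + C) * norm (w - z + s *\<^sub>R h)" using 1 by (simp add: distrib_right)
  also have "\<dots> \<le> (1 + C) * (M * norm w)" using 2 \<open>C \<ge> 0\<close> by (intro mult_left_mono) auto
  finally have "2 / \<tau> * (s * norm h) \<le> 2 / \<tau> * ((1 + C) * (M * norm w))"
    using \<open>0 < \<tau>\<close> by (intro mult_left_mono) auto
  moreover have "2 / \<tau> * (s * norm h) = \<alpha> * norm h" using \<open>0 < \<tau>\<close> by (simp add: s_def)
  ultimately show ?thesis by (simp only: h_def mult.assoc)
qed

text \<open>
  Here the coefficients of the flat vector are so large that the thresholding set is \<open>G\<close>, and separation
  turns the distance of \<open>y\<close> to the span over \<open>G\<close> into its norm.  The competitor \<open>q\<close> is left free: \<open>q = y\<close> gives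
  dominance, and \<open>y = w - P F w\<close> with \<open>q = - P F w\<close> gives the thresholding bound.
\<close>

lemma WSG_bounded_by_flat_vector:
  assumes "0 < \<tau>" "\<tau> \<le> 1" and M: "M > 0"
    "\<And>v m. m \<ge> 1 \<Longrightarrow> \<exists>W z. weak_thresholding_set e' \<tau> v m W \<and> P W z = z \<and>
        norm (v - z) \<le> M * best_error smul e e' m v"
    and S: "finite S" "P S y = y" "\<And>i. norm (e' i y) \<le> \<alpha>" "\<alpha> > 0"
    and Q: "finite Q" "P Q q = q" "card Q \<le> card G"
    and G: "finite G" "card G \<ge> 1" "S \<inter> G = {}" "separated C S G" and "C \<ge> 0"
  shows "norm y \<le> C * M * (norm (y - q) + 2 / \<tau> * (\<alpha> * norm (comb G (\<lambda>_. 1))))"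
proof -
  define h where "h = comb G (\<lambda>_. 1)"
  have h: "P G h = h" "\<And>i. e' i h = (if i \<in> G then 1 else 0)"
    using G by (auto simp: h_def proj_comb coord_comb)
  define s where "s = 2 * \<alpha> / \<tau>"
  have "s > 0" using assms by (simp add: s_def)
  define v where "v = y + s *\<^sub>R h"
  have y_off: "e' i y = 0" if "i \<notin> S" for i using coord_outside[OF S(2,1) that] .
  have v: "e' i v = (if i \<in> G then of_real s else e' i y)" for i
    using y_off[of i] G(3) by (auto simp: v_def h scaleR_conv_of_real)
  obtain W z where W: "weak_thresholding_set e' \<tau> v (card G) W" and z: "P W z = z"
    "norm (v - z) \<le> M * best_error smul e e' (card G) v" using M(2)[OF G(2), of v] by auto
  have small: "norm (e' i y) < 2 * \<alpha>" for i using S(3)[of i] S(4) by linarith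
  have "W = G"
    by (rule weak_thresholding_set_unique[OF W G(1) refl, of s])
      (use assms(1,2) \<open>s > 0\<close> small in \<open>auto simp: v\<close>, auto simp: s_def)
  then have "P G (s *\<^sub>R h - z) = s *\<^sub>R h - z" using z(1) by (simp add: proj_diff proj_scaleR h)
  then have "norm y \<le> C * norm (y + (s *\<^sub>R h - z))"
    using G(4) S(2) by (simp add: separated_def)
  also have "y + (s *\<^sub>R h - z) = v - z" by (simp add: v_def)
  also have "C * norm (v - z) \<le> C * (M * best_error smul e e' (card G) v)"
    using z(2) \<open>C \<ge> 0\<close> by (intro mult_left_mono)
  also have "\<dots> \<le> C * (M * norm (v - q))"
    using \<open>C \<ge> 0\<close> M(1) Q by (intro mult_left_mono best_error_le) auto
  also have "\<dots> \<le> C * (M * (norm (y - q) + s * norm h))"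
  proof -
    have "v - q = (y - q) + s *\<^sub>R h" by (simp add: v_def)
    then have "norm (v - q) \<le> norm (y - q) + s * norm h"
      using norm_triangle_ineq[of "y - q" "s *\<^sub>R h"] \<open>s > 0\<close> by (simp only: norm_scaleR)
    then show ?thesis using \<open>C \<ge> 0\<close> M(1) by (intro mult_left_mono) auto
  qed
  finally show ?thesis by (simp add: s_def h_def mult.assoc)
qed

text \<open>
  For finitely supported vectors the two preceding lemmas combine through a flat vector on a set \<open>G\<close>
  separated from all supports involved.  General vectors are reached by density; since an approximation
  may violate the thresholding condition slightly, the bound for finitely supported vectors allows
  coordinates up to \<open>2 * \<alpha>\<close> outside \<open>F\<close>.
\<close>

lemma WSG_bounds:
  assumes WSG: "WSG smul e e' \<tau>" and "0 < \<tau>" "\<tau> \<le> 1" and bc: "bounded_coordinates e'"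
  shows "\<exists>K C. thresholding_bound K \<and> dominance_bound C"
proof -
  obtain M where M: "M > 0"
    "\<And>v m. m \<ge> 1 \<Longrightarrow> \<exists>W z. weak_thresholding_set e' \<tau> v m W \<and> P W z = z \<and>
        norm (v - z) \<le> M * best_error smul e e' m v"
    using WSG in_span_iff unfolding WSG_def weak_thresholding_set_def by metis
  obtain B where B: "\<And>i. norm (e i) \<le> B"
    using WSG_basis_bounded[OF bc assms(2,3) M] by blast
  obtain c where c: "\<And>i v. norm (e' i v) \<le> c * norm v" "c > 0"
    using bc bounded_coordinates_iff by blast
  obtain D N0 where D: "D > 0" and N0: "infinite N0" and far:
    "\<And>E N m. finite E \<Longrightarrow> N \<subseteq> N0 \<Longrightarrow> infinite N \<Longrightarrow>
       \<exists>G\<subseteq>N. finite G \<and> card G = m \<and> separated D E G"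
    using far_sets_separated[OF bc B] by metis
  have G_ex: "\<exists>G. finite G \<and> card G = m \<and> S \<inter> G = {} \<and> separated D S G" if S: "finite S" for S m
  proof -
    have "infinite (N0 - S)" using N0 S by simp
    then obtain G where "G \<subseteq> N0 - S" "finite G" "card G = m" "separated D S G"
      using far[OF S, of "N0 - S" m] by blast
    then show ?thesis by blast
  qed
  define K1 where "K1 = 2 / \<tau> * (1 + D) * M"
  have "K1 > 0" using D M(1) \<open>0 < \<tau>\<close> by (simp add: K1_def)
  define C where "C = D * M * (2 / \<tau> * K1)"
  have "C > 0" using D M(1) \<open>0 < \<tau>\<close> \<open>K1 > 0\<close> by (simp add: C_def)
  have dom: "norm (comb E a) \<le> C * norm w"
    if S: "finite S" "P S w = w" and E: "finite E" "\<And>i. i \<in> E \<Longrightarrow> norm (a i) \<le> \<alpha>" and "\<alpha> > 0"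
      and F: "finite F" "card F \<ge> 1" "card E \<le> card F" "\<And>i. i \<in> F \<Longrightarrow> \<alpha> \<le> norm (e' i w)"
    for S w E a \<alpha> F
  proof -
    obtain G where G: "finite G" "card G = card F" "(S \<union> E) \<inter> G = {}" "separated D (S \<union> E) G"
      using G_ex[of "S \<union> E" "card F"] S E by auto
    have sep: "separated D S G" "separated D E G"
      using separated_subset[OF G(4)] S(1) E(1) by auto
    have flat: "\<alpha> * norm (comb G (\<lambda>_. 1)) \<le> K1 * norm w"
      unfolding K1_def using S F G sep D \<open>\<alpha> > 0\<close> assms(2,3)
      by (intro WSG_bounds_flat_vector[OF _ _ M, where S = S and F = F]) auto
    have "norm (comb E a) \<le> D * M * (norm (comb E a - comb E a) + 2 / \<tau> * (\<alpha> * norm (comb G (\<lambda>_. 1))))"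
      using E F G sep D \<open>\<alpha> > 0\<close> assms(2,3)
      by (intro WSG_bounded_by_flat_vector[OF _ _ M, where S = E and Q = E])
        (auto simp: proj_comb coord_comb)
    also have "\<dots> = D * M * (2 / \<tau> * (\<alpha> * norm (comb G (\<lambda>_. 1))))" by simp
    also have "\<dots> \<le> D * M * (2 / \<tau> * (K1 * norm w))"
      using flat D M(1) \<open>0 < \<tau>\<close> by (intro mult_left_mono) auto
    finally show ?thesis by (simp only: C_def mult.assoc)
  qed
  have C: "dominance_bound (4 * C)"
  proof (rule dominance_boundI)
    show "0 \<le> 4 * C" using \<open>C > 0\<close> by simp
    fix E F :: "nat set" and a :: "nat \<Rightarrow> 'k" and v :: 'a and \<alpha> :: real
    assume E: "finite E" "\<And>i. i \<in> E \<Longrightarrow> norm (a i) \<le> \<alpha>"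
      and F: "finite F" "card F \<ge> 1" "\<And>i. i \<in> F \<Longrightarrow> \<alpha> \<le> norm (e' i v)"
      and EF: "card E \<le> card F" and "\<alpha> > 0"
    obtain i where "i \<in> F" using F(2) by (metis card.empty ex_in_conv not_one_le_zero)
    then have "v \<noteq> 0" using F(3)[of i] \<open>\<alpha> > 0\<close> by auto
    define \<delta> where "\<delta> = min (norm v) (\<alpha> / (2 * c))"
    have "\<delta> > 0" using \<open>v \<noteq> 0\<close> \<open>\<alpha> > 0\<close> c(2) by (simp add: \<delta>_def)
    then obtain S w where S: "finite S" "P S w = w" and w: "norm (v - w) < \<delta>"
      using finitely_supported_dense by blast
    have near: "norm (e' j v - e' j w) \<le> \<alpha> / 2" for j
    proof -
      have "norm (e' j v - e' j w) \<le> c * norm (v - w)" using c(1)[of j "v - w"] by simp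
      also have "\<dots> \<le> c * (\<alpha> / (2 * c))" using w c(2) by (intro mult_left_mono) (auto simp: \<delta>_def)
      finally show ?thesis using c(2) by simp
    qed
    have "\<alpha> \<le> norm (e' j (2 *\<^sub>R w))" if "j \<in> F" for j
      using F(3)[OF that] near[of j] norm_triangle_ineq2[of "e' j v" "e' j w"] by simp
    then have "norm (comb E a) \<le> C * norm (2 *\<^sub>R w)"
      using E F EF \<open>\<alpha> > 0\<close> S by (intro dom[of S _ E _ \<alpha> F]) (auto simp: proj_scaleR)
    also have "\<dots> \<le> C * (4 * norm v)"
      using w norm_triangle_sub[of w v] \<open>C > 0\<close>
      by (intro mult_left_mono) (auto simp: \<delta>_def norm_minus_commute)
    finally show "norm (comb E a) \<le> 4 * C * norm v" by simp
  qed
  define K where "K = D * M * (1 + 4 / \<tau> * K1)"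
  have "K > 0" using D M(1) \<open>0 < \<tau>\<close> \<open>K1 > 0\<close> by (simp add: K_def add_pos_pos)
  have thr: "norm (w - P F w) \<le> K * norm w"
    if S: "finite S" "P S w = w" and "\<alpha> > 0" and F: "finite F" "card F \<ge> 1"
      "\<And>i. i \<in> F \<Longrightarrow> \<alpha> \<le> norm (e' i w)" "\<And>i. i \<notin> F \<Longrightarrow> norm (e' i w) \<le> 2 * \<alpha>"
    for S w \<alpha> F
  proof -
    obtain G where G: "finite G" "card G = card F" "S \<inter> G = {}" "separated D S G"
      using G_ex[OF S(1)] by blast
    have flat: "\<alpha> * norm (comb G (\<lambda>_. 1)) \<le> K1 * norm w"
      unfolding K1_def using S F G D \<open>\<alpha> > 0\<close> assms(2,3)
      by (intro WSG_bounds_flat_vector[OF _ _ M]) auto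
    have "F \<subseteq> S" using F(3) coord_outside[OF S(2,1)] \<open>\<alpha> > 0\<close> by fastforce
    have PF: "P F (- P F w) = - P F w"
      using proj_scaleR[of F "-1" "P F w"] F(1) by (simp add: proj_proj)
    have "norm (w - P F w) \<le> D * M * (norm ((w - P F w) - (- P F w)) + 2 / \<tau> * (2 * \<alpha> * norm (comb G (\<lambda>_. 1))))"
    proof (rule WSG_bounded_by_flat_vector[OF assms(2,3) M S(1) _ _ _ F(1) PF])
      show "P S (w - P F w) = w - P F w"
        using S F(1) \<open>F \<subseteq> S\<close> by (simp add: proj_diff proj_proj Int_absorb1)
      show "norm (e' i (w - P F w)) \<le> 2 * \<alpha>" for i
        using F(1,4) \<open>\<alpha> > 0\<close> by (simp add: coord_proj)
    qed (use \<open>\<alpha> > 0\<close> G F D in auto)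
    also have "\<dots> = D * M * (norm w + 4 / \<tau> * (\<alpha> * norm (comb G (\<lambda>_. 1))))" by simp
    also have "\<dots> \<le> D * M * (norm w + 4 / \<tau> * (K1 * norm w))"
      using flat D M(1) \<open>0 < \<tau>\<close> by (intro mult_left_mono add_left_mono) auto
    finally show ?thesis by (simp add: K_def algebra_simps)
  qed
  have "thresholding_bound (K + 1)"
  proof (rule thresholding_boundI)
    show "1 \<le> K + 1" using \<open>K > 0\<close> by simp
    fix v F and \<alpha> :: real
    assume F: "finite F" "card F \<ge> 1" and "\<alpha> > 0" and large: "\<And>i. i \<in> F \<Longrightarrow> \<alpha> \<le> norm (e' i v)"
      and small: "\<And>i. i \<notin> F \<Longrightarrow> norm (e' i v) \<le> \<alpha>"
    have approx: "norm (w - P F w) \<le> K * norm w"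
      if "finite S" "P S w = w" and w: "norm (v - w) < \<alpha> / (4 * c)" for S w
    proof -
      have near: "norm (e' j v - e' j w) \<le> \<alpha> / 4" for j
      proof -
        have "norm (e' j v - e' j w) \<le> c * norm (v - w)" using c(1)[of j "v - w"] by simp
        also have "\<dots> \<le> c * (\<alpha> / (4 * c))" using w c(2) by (intro mult_left_mono) auto
        finally show ?thesis using c(2) by simp
      qed
      have near': "norm (e' j w - e' j v) \<le> \<alpha> / 4" for j
        using near[of j] by (simp add: norm_minus_commute)
      show ?thesis
      proof (rule thr[OF that(1,2), of "3 / 4 * \<alpha>"])
        show "3 / 4 * \<alpha> \<le> norm (e' i w)" if "i \<in> F" for i
          using large[OF that] near[of i] norm_triangle_ineq2[of "e' i v" "e' i w"] by linarith
        show "norm (e' i w) \<le> 2 * (3 / 4 * \<alpha>)" if "i \<notin> F" for i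
          using small[OF that] near'[of i] norm_triangle_ineq2[of "e' i w" "e' i v"] \<open>\<alpha> > 0\<close> by linarith
      qed (use \<open>\<alpha> > 0\<close> F in auto)
    qed
    have "\<exists>S w. finite S \<and> P S w = w \<and> norm (v - w) < min (1 / real (Suc n)) (\<alpha> / (4 * c))" for n
    proof -
      have pos: "0 < min (1 / real (Suc n)) (\<alpha> / (4 * c))" using \<open>\<alpha> > 0\<close> c(2) by simp
      obtain S w where "finite S" "P S w = w" "norm (v - w) < min (1 / real (Suc n)) (\<alpha> / (4 * c))"
        by (rule finitely_supported_dense[OF pos])
      then show ?thesis by blast
    qed
    then obtain w where w: "\<And>n. \<exists>S. finite S \<and> P S (w n) = w n"
      "\<And>n. norm (v - w n) < min (1 / real (Suc n)) (\<alpha> / (4 * c))" by metis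
    have "(\<lambda>n. v - w n) \<longlonglongrightarrow> 0"
      using w(2) by (intro Lim_null_comparison[OF _ LIMSEQ_inverse_real_of_nat])
        (auto simp: inverse_eq_divide less_imp_le)
    then have lim: "w \<longlonglongrightarrow> v"
      using tendsto_diff[OF tendsto_const[of v], of "\<lambda>n. v - w n" 0] by simp
    have "norm (w n - P F (w n)) \<le> K * norm (w n)" for n
      using approx w[of n] by auto
    moreover have "(\<lambda>n. norm (w n - P F (w n))) \<longlonglongrightarrow> norm (v - P F v)"
      "(\<lambda>n. K * norm (w n)) \<longlonglongrightarrow> K * norm v"
      by (intro tendsto_intros lim proj_tendsto)+
    ultimately have "norm (v - P F v) \<le> K * norm v"
      using LIMSEQ_le by blast
    then show "norm (v - P F v) \<le> (K + 1) * norm v" by (simp add: distrib_right add_increasing2)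
  qed
  then show ?thesis using C by blast
qed

section \<open>Equivalence of the greedy properties\<close>

lemma almost_greedy_imp_WAG:
  assumes "almost_greedy smul e e'"
  shows "WAG smul e e' 1"
  using assms greedy_set_thresholding unfolding almost_greedy_def WAG_def greedy_sum_def by blast

lemma semi_greedy_imp_WSG:
  assumes "semi_greedy smul e e'"
  shows "WSG smul e e' 1"
  using assms greedy_set_thresholding unfolding semi_greedy_def WSG_def by blast

lemma WAG_mono: "WAG smul e e' \<tau> \<Longrightarrow> \<tau>' \<le> \<tau> \<Longrightarrow> WAG smul e e' \<tau>'"
  unfolding WAG_def using weak_thresholding_set_mono by meson

lemma WSG_mono: "WSG smul e e' \<tau> \<Longrightarrow> \<tau>' \<le> \<tau> \<Longrightarrow> WSG smul e e' \<tau>'"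
  unfolding WSG_def using weak_thresholding_set_mono by meson

lemma WAG_imp_almost_greedy:
  assumes "WAG smul e e' \<tau>" "0 < \<tau>" "\<tau> \<le> 1"
  shows "almost_greedy smul e e'"
proof -
  have "\<exists>W. weak_thresholding_set e' \<tau> v 1 W" for v
    using assms(1) unfolding WAG_def by blast
  then have "bounded_coordinates e'"
    by (rule bounded_coordinates_of_weak_thresholding[OF assms(2)])
  then show ?thesis using WAG_bounds[OF assms] almost_greedyI by blast
qed

lemma WSG_imp_almost_greedy:
  assumes "WSG smul e e' \<tau>" "0 < \<tau>" "\<tau> \<le> 1"
  shows "almost_greedy smul e e'"
proof -
  have "\<exists>W. weak_thresholding_set e' \<tau> v 1 W" for v
    using assms(1) unfolding WSG_def by blast
  then have bc: "bounded_coordinates e'"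
    by (rule bounded_coordinates_of_weak_thresholding[OF assms(2)])
  then show ?thesis using WSG_bounds[OF assms bc] almost_greedyI by blast
qed

lemma almost_greedy_imp_semi_greedy:
  assumes "almost_greedy smul e e'"
  shows "semi_greedy smul e e'"
proof -
  have "\<exists>K C. thresholding_bound K \<and> dominance_bound C"
    by (rule WAG_bounds[OF almost_greedy_imp_WAG[OF assms]]) auto
  then show ?thesis using assms semi_greedyI unfolding almost_greedy_def by blast
qed

end

theorem corollary4p3:
  fixes smul :: "'k::{real_normed_field, euclidean_space} \<Rightarrow> 'a::banach \<Rightarrow> 'a"
    and e :: "nat \<Rightarrow> 'a" and e' :: "nat \<Rightarrow> 'a \<Rightarrow> 'k"
  assumes "banach_space_over smul"
    and "infinite_dimensional smul"
    and "markushevich_basis smul e e'"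
  shows "((\<forall>\<tau>. 0 < \<tau> \<and> \<tau> \<le> 1 \<longrightarrow> WSG smul e e' \<tau>) \<longleftrightarrow> (\<exists>\<tau>. 0 < \<tau> \<and> \<tau> \<le> 1 \<and> WSG smul e e' \<tau>)) \<and>
    ((\<exists>\<tau>. 0 < \<tau> \<and> \<tau> \<le> 1 \<and> WSG smul e e' \<tau>) \<longleftrightarrow> (\<forall>\<tau>. 0 < \<tau> \<and> \<tau> \<le> 1 \<longrightarrow> WAG smul e e' \<tau>)) \<and>
    ((\<forall>\<tau>. 0 < \<tau> \<and> \<tau> \<le> 1 \<longrightarrow> WAG smul e e' \<tau>) \<longleftrightarrow> (\<exists>\<tau>. 0 < \<tau> \<and> \<tau> \<le> 1 \<and> WAG smul e e' \<tau>)) \<and>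
    ((\<exists>\<tau>. 0 < \<tau> \<and> \<tau> \<le> 1 \<and> WAG smul e e' \<tau>) \<longleftrightarrow> semi_greedy smul e e') \<and>
    (semi_greedy smul e e' \<longleftrightarrow> almost_greedy smul e e')"
proof -
  interpret M_basis smul e e'
    using assms(1,3) by (intro M_basis.intro M_basis_axioms.intro)
  let ?AG = "almost_greedy smul e e'"
  have WAG: "WAG smul e e' \<tau>" if ?AG "\<tau> \<le> 1" for \<tau>
    using that almost_greedy_imp_WAG WAG_mono by blast
  have WSG: "WSG smul e e' \<tau>" if ?AG "\<tau> \<le> 1" for \<tau>
    using that almost_greedy_imp_semi_greedy semi_greedy_imp_WSG WSG_mono by blast
  have one: "0 < (1::real) \<and> (1::real) \<le> 1" by simp
  have "(\<forall>\<tau>. 0 < \<tau> \<and> \<tau> \<le> 1 \<longrightarrow> WSG smul e e' \<tau>) \<longleftrightarrow> ?AG"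
    using WSG WSG_imp_almost_greedy one by blast
  moreover have "(\<exists>\<tau>. 0 < \<tau> \<and> \<tau> \<le> 1 \<and> WSG smul e e' \<tau>) \<longleftrightarrow> ?AG"
    using WSG WSG_imp_almost_greedy one by blast
  moreover have "(\<forall>\<tau>. 0 < \<tau> \<and> \<tau> \<le> 1 \<longrightarrow> WAG smul e e' \<tau>) \<longleftrightarrow> ?AG"
    using WAG WAG_imp_almost_greedy one by blast
  moreover have "(\<exists>\<tau>. 0 < \<tau> \<and> \<tau> \<le> 1 \<and> WAG smul e e' \<tau>) \<longleftrightarrow> ?AG"
    using WAG WAG_imp_almost_greedy one by blast
  moreover have "semi_greedy smul e e' \<longleftrightarrow> ?AG"
    using almost_greedy_imp_semi_greedy semi_greedy_imp_WSG WSG_imp_almost_greedy one by blast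
  ultimately show ?thesis by simp
qed

end
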